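(* Suppose the one-period demand $D$ has an exponential distribution with mean $\mu$. Let $r^*\in\operatorname{argmin}_{r\in[0,\mu)}C(\mathrm{C}^r)$ be an optimal constant order quantity, let $U(r)=p(\mu-r)/h$, and let $C^*$ be the optimal cost-rate of the lost sales system with lead time $\tau$. With $h$, $p$ and the demand distribution fixed, $$\lim_{\tau\to\infty}\left(C(\mathrm{P}^{U(r^* )})-C^*\right)=0.$$
   Context: Lost sales inventory system. Periods are $t\in\mathbb{N}_0=\{0,1,2,\dots\}$; $\tau\in\mathbb{N}_0$ is the lead time, $h>0$ the holding cost and $p>0$ the lost sales penalty cost. Demands $D_0,D_1,\dots$ are i.i.d. nonnegative random variables distributed as $D$, with $\mu=\mathbb{E}[D]<\infty$. $q_t\ge 0$ is the order arriving at the start of period $t$; the order $q_{t+\tau}$ is placed in period $t$, before $D_t$ is observed. $I_t$ is the inventory at the start of period $t$ after receiving $q_t$. With $(x)^+=\max(0,x)$, the dynamics are $L_t=(D_t-I_t)^+$ (lost sales), $J_t=(I_t-D_t)^+$ (end-of-period inventory), $I_t=J_{t-1}+q_t$. The state in period $t$ is $\mathbf{x}_t=(I_t,q_{t+1},\dots,q_{t+\tau-1})\in\mathbb{R}_+^\tau$ (for $\tau=0$ it is the inventory $J_{t-1}$ before ordering). A policy $\mathrm{A}=\{\mathrm{A}_t\}_{t\in\mathbb{N}_0}$ is a sequence of (measurable) functions setting $q_{t+\tau}=\mathrm{A}_t(\mathbf{x}_t)\ge 0$. The initial state is $\mathbf{x}_0=\mathbf{0}$, i.e. $I_0=0$ and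 $q_t=0$ for $t<\tau$ (for $\tau=0$: $J_{-1}=0$). The constant order policy $\mathrm{C}^r$, with $0\le r<\mu$, is $\mathrm{C}^r_t(\mathbf{x}_t)=r$. The projected inventory level (PIL) policy $\mathrm{P}^U$, $U\ge 0$, is $\mathrm{P}^U_t(\mathbf{x}_t)=(U-\mathbb{E}[J_{t+\tau-1}\mid\mathbf{x}_t])^+$. The cost in period $t$ is $c_t=hJ_t+pL_t$, and the cost-rate of a policy $\mathrm{A}$ is $C(\mathrm{A})=\limsup_{T\to\infty}\mathbb{E}\big[\frac{1}{T-\tau+1}\sum_{t=\tau}^T c_t\big]$, with costs incurred under $\mathrm{A}$. $C^*$ is the long-run expected cost-rate of an optimal policy, i.e. the infimum of $C(\mathrm{A})$ over all policies $\mathrm{A}$; it depends on $\tau$. *)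

theory Defs
  imports "HOL-Probability.Probability"
begin

text \<open>
  A state is a vector of dimension \<open>max 1 \<tau>\<close>, indexed from 0, with the Borel structure of the
  nonnegative orthant.  For \<open>\<tau> \<ge> 1\<close> component 0 is \<open>I\<^sub>t\<close> and component \<open>i \<ge> 1\<close> is
  \<open>q\<^bsub>t+i\<^esub>\<close>; for \<open>\<tau> = 0\<close> the only component is \<open>J\<^bsub>t-1\<^esub>\<close>.
\<close>

type_synonym policy = "nat \<Rightarrow> (nat \<Rightarrow> real) \<Rightarrow> real"

definition state_space :: "nat \<Rightarrow> (nat \<Rightarrow> real) measure" where
  "state_space \<tau> = Pi\<^sub>M {..<max 1 \<tau>} (\<lambda>_. restrict_space borel {0..})"

definition policies :: "nat \<Rightarrow> policy set" where
  "policies \<tau> = {A. \<forall>t. A t \<in> state_space \<tau> \<rightarrow>\<^sub>M restrict_space borel {0..}}"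

lemma restrict_fundef_cong [fundef_cong]:
  "A = B \<Longrightarrow> (\<And>x. x \<in> B \<Longrightarrow> f x = g x) \<Longrightarrow> restrict f A = restrict g B"
  by (auto simp: restrict_def)

text \<open>
  Sample paths of the system with lead time \<open>\<tau>\<close> under the policy \<open>A\<close> and the demand path \<open>d\<close>:
  \<open>order_qty \<tau> A d s\<close> is \<open>q\<^sub>s\<close>, \<open>inv_level \<tau> A d t\<close> is \<open>I\<^sub>t\<close>, and \<open>prior_inv \<tau> A d t\<close> is
  \<open>J\<^bsub>t-1\<^esub>\<close>, shifted by one period in order to cover \<open>J\<^bsub>-1\<^esub> = 0\<close>.
\<close>

function prior_inv :: "nat \<Rightarrow> policy \<Rightarrow> (nat \<Rightarrow> real) \<Rightarrow> nat \<Rightarrow> real"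
  and order_qty :: "nat \<Rightarrow> policy \<Rightarrow> (nat \<Rightarrow> real) \<Rightarrow> nat \<Rightarrow> real"
  and inv_level :: "nat \<Rightarrow> policy \<Rightarrow> (nat \<Rightarrow> real) \<Rightarrow> nat \<Rightarrow> real"
where
  "prior_inv \<tau> A d t = (if t = 0 then 0 else max 0 (inv_level \<tau> A d (t - 1) - d (t - 1)))"
| "order_qty \<tau> A d s =
    (if s < \<tau> then 0
     else A (s - \<tau>) (\<lambda>i\<in>{..<max 1 \<tau>}.
            if i = 0 then (if \<tau> = 0 then prior_inv \<tau> A d s else inv_level \<tau> A d (s - \<tau>))
            else order_qty \<tau> A d (s - \<tau> + i)))"
| "inv_level \<tau> A d t = prior_inv \<tau> A d t + order_qty \<tau> A d t"
  by pat_completeness auto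
termination
  by (relation "inv_image less_than (\<lambda>x. case x of
        Inl (\<tau>, A, d, t) \<Rightarrow> 3 * t
      | Inr (Inl (\<tau>, A, d, t)) \<Rightarrow> 3 * t + 1
      | Inr (Inr (\<tau>, A, d, t)) \<Rightarrow> 3 * t + 2)") auto

declare prior_inv.simps [simp del] order_qty.simps [simp del] inv_level.simps [simp del]

definition sys_state :: "nat \<Rightarrow> policy \<Rightarrow> (nat \<Rightarrow> real) \<Rightarrow> nat \<Rightarrow> nat \<Rightarrow> real" where
  "sys_state \<tau> A d t = (\<lambda>i\<in>{..<max 1 \<tau>}.
     if i = 0 then (if \<tau> = 0 then prior_inv \<tau> A d t else inv_level \<tau> A d t)
     else order_qty \<tau> A d (t + i))"

definition end_inv :: "nat \<Rightarrow> policy \<Rightarrow> (nat \<Rightarrow> real) \<Rightarrow> nat \<Rightarrow> real" where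
  "end_inv \<tau> A d t = max 0 (inv_level \<tau> A d t - d t)"

definition lost_sales :: "nat \<Rightarrow> policy \<Rightarrow> (nat \<Rightarrow> real) \<Rightarrow> nat \<Rightarrow> real" where
  "lost_sales \<tau> A d t = max 0 (d t - inv_level \<tau> A d t)"

definition period_cost ::
  "real \<Rightarrow> real \<Rightarrow> nat \<Rightarrow> policy \<Rightarrow> (nat \<Rightarrow> real) \<Rightarrow> nat \<Rightarrow> real" where
  "period_cost h p \<tau> A d t = h * end_inv \<tau> A d t + p * lost_sales \<tau> A d t"

text \<open>
  Costs are nonnegative but need not be integrable under an arbitrary policy, so that the
  expectation is a nonnegative integral and the cost-rate is an extended real.
\<close>

definition cost_rate ::
  "'a measure \<Rightarrow> (nat \<Rightarrow> 'a \<Rightarrow> real) \<Rightarrow> real \<Rightarrow> real \<Rightarrow> nat \<Rightarrow> policy \<Rightarrow> ereal" where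
  "cost_rate M D h p \<tau> A =
     limsup (\<lambda>T. enn2ereal (\<integral>\<^sup>+\<omega>. ennreal (1 / (real T - real \<tau> + 1) *
        (\<Sum>t=\<tau>..T. period_cost h p \<tau> A (\<lambda>s. D s \<omega>) t)) \<partial>M))"

definition optimal_cost_rate ::
  "'a measure \<Rightarrow> (nat \<Rightarrow> 'a \<Rightarrow> real) \<Rightarrow> real \<Rightarrow> real \<Rightarrow> nat \<Rightarrow> ereal" where
  "optimal_cost_rate M D h p \<tau> = (INF A\<in>policies \<tau>. cost_rate M D h p \<tau> A)"

definition const_policy :: "real \<Rightarrow> policy" where
  "const_policy r = (\<lambda>t x. r)"

text \<open>
  \<open>proj_inv x e k\<close> is \<open>I\<^bsub>t+k\<^esub>\<close> for \<open>k < \<tau>\<close> and \<open>proj_end_inv \<tau> x e\<close> is \<open>J\<^bsub>t+\<tau>-1\<^esub>\<close> when the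
  state in period \<open>t\<close> is \<open>x\<close> and the demands from period \<open>t\<close> on are \<open>e\<^sub>0, e\<^sub>1, \<dots>\<close>.  As \<open>x\<^sub>t\<close> depends
  only on the demands before period \<open>t\<close>, averaging over the demands from period \<open>t\<close> on gives
  \<open>E[J\<^bsub>t+\<tau>-1\<^esub> | x\<^sub>t = x]\<close>; see \<open>nn_cond_exp_end_inv\<close> below.
\<close>

primrec proj_inv :: "(nat \<Rightarrow> real) \<Rightarrow> (nat \<Rightarrow> real) \<Rightarrow> nat \<Rightarrow> real" where
  "proj_inv x e 0 = x 0"
| "proj_inv x e (Suc k) = max 0 (proj_inv x e k - e k) + x (Suc k)"

definition proj_end_inv :: "nat \<Rightarrow> (nat \<Rightarrow> real) \<Rightarrow> (nat \<Rightarrow> real) \<Rightarrow> real" where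
  "proj_end_inv \<tau> x e = (if \<tau> = 0 then x 0 else max 0 (proj_inv x e (\<tau> - 1) - e (\<tau> - 1)))"

definition expected_end_inv ::
  "'a measure \<Rightarrow> (nat \<Rightarrow> 'a \<Rightarrow> real) \<Rightarrow> nat \<Rightarrow> nat \<Rightarrow> (nat \<Rightarrow> real) \<Rightarrow> real" where
  "expected_end_inv M D \<tau> t x = (\<integral>\<omega>. proj_end_inv \<tau> x (\<lambda>k. D (t + k) \<omega>) \<partial>M)"

definition pil_policy :: "'a measure \<Rightarrow> (nat \<Rightarrow> 'a \<Rightarrow> real) \<Rightarrow> nat \<Rightarrow> real \<Rightarrow> policy" where
  "pil_policy M D \<tau> U = (\<lambda>t x. max 0 (U - expected_end_inv M D \<tau> t x))"


subsection \<open>The projected inventory level as a conditional expectation\<close>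

lemma sample_path_cong:
  assumes "\<And>i. i < n \<Longrightarrow> d i = d' i"
  shows "(s \<le> n \<longrightarrow> prior_inv \<tau> A d s = prior_inv \<tau> A d' s) \<and>
    (s \<le> n + \<tau> \<longrightarrow> order_qty \<tau> A d s = order_qty \<tau> A d' s) \<and>
    (s \<le> n \<longrightarrow> inv_level \<tau> A d s = inv_level \<tau> A d' s)"
proof (induction s rule: less_induct)
  case (less s)
  have P: "prior_inv \<tau> A d s = prior_inv \<tau> A d' s" if "s \<le> n"
  proof (cases "s = 0")
    case False
    then have "inv_level \<tau> A d (s - 1) = inv_level \<tau> A d' (s - 1)" "d (s - 1) = d' (s - 1)"
      using less.IH[of "s - 1"] that assms[of "s - 1"] by auto
    then show ?thesis
      by (simp add: prior_inv.simps[of _ _ _ s])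
  qed (simp add: prior_inv.simps)
  have Q: "order_qty \<tau> A d s = order_qty \<tau> A d' s" if "s \<le> n + \<tau>"
  proof (cases "s < \<tau>")
    case False
    have "(if i = 0 then (if \<tau> = 0 then prior_inv \<tau> A d s else inv_level \<tau> A d (s - \<tau>))
            else order_qty \<tau> A d (s - \<tau> + i)) =
          (if i = 0 then (if \<tau> = 0 then prior_inv \<tau> A d' s else inv_level \<tau> A d' (s - \<tau>))
            else order_qty \<tau> A d' (s - \<tau> + i))" if "i < max 1 \<tau>" for i
    proof -
      have "i < \<tau> \<or> i = 0" using that by auto
      then show ?thesis
        using P less.IH[of "s - \<tau>"] less.IH[of "s - \<tau> + i"] \<open>s \<le> n + \<tau>\<close> False by auto
    qed
    then have "(\<lambda>i\<in>{..<max 1 \<tau>}.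
           if i = 0 then (if \<tau> = 0 then prior_inv \<tau> A d s else inv_level \<tau> A d (s - \<tau>))
           else order_qty \<tau> A d (s - \<tau> + i)) =
         (\<lambda>i\<in>{..<max 1 \<tau>}.
           if i = 0 then (if \<tau> = 0 then prior_inv \<tau> A d' s else inv_level \<tau> A d' (s - \<tau>))
           else order_qty \<tau> A d' (s - \<tau> + i))"
      by (intro restrict_ext) blast
    then show ?thesis
      by (simp only: order_qty.simps[of _ _ _ s])
  qed (simp add: order_qty.simps)
  show ?case
    using P Q by (auto simp: inv_level.simps[of _ _ _ s])
qed

lemma measurable_nonneg:
  assumes "f \<in> borel_measurable N" "\<And>x. x \<in> space N \<Longrightarrow> f x \<ge> (0::real)"
  shows "f \<in> N \<rightarrow>\<^sub>M restrict_space borel {0..}"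
  using assms by (intro measurable_restrict_space2) auto

lemma measurable_nonnegD:
  assumes "f \<in> N \<rightarrow>\<^sub>M restrict_space borel {0::real..}"
  shows "f \<in> borel_measurable N" "x \<in> space N \<Longrightarrow> f x \<ge> 0"
  using assms by (auto simp: measurable_restrict_space2_iff)

lemma sample_path_measurable:
  assumes A: "A \<in> policies \<tau>"
  shows "(s \<le> n \<longrightarrow> (\<lambda>d. prior_inv \<tau> A d s) \<in> Pi\<^sub>M {..<n} (\<lambda>_. borel) \<rightarrow>\<^sub>M restrict_space borel {0..}) \<and>
    (s \<le> n + \<tau> \<longrightarrow> (\<lambda>d. order_qty \<tau> A d s) \<in> Pi\<^sub>M {..<n} (\<lambda>_. borel) \<rightarrow>\<^sub>M restrict_space borel {0..}) \<and>
    (s \<le> n \<longrightarrow> (\<lambda>d. inv_level \<tau> A d s) \<in> Pi\<^sub>M {..<n} (\<lambda>_. borel) \<rightarrow>\<^sub>M restrict_space borel {0..})"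
    (is "(_ \<longrightarrow> ?P s) \<and> (_ \<longrightarrow> ?Q s) \<and> (_ \<longrightarrow> ?R s)")
proof (induction s rule: less_induct)
  case (less s)
  have P: "?P s" if "s \<le> n"
  proof (cases "s = 0")
    case True
    then show ?thesis
      by (simp add: prior_inv.simps measurable_nonneg)
  next
    case False
    then have "?R (s - 1)" "s - 1 \<in> {..<n}"
      using less.IH[of "s - 1"] that by auto
    then show ?thesis
      using False unfolding prior_inv.simps[of _ _ _ s]
      by (intro measurable_nonneg)
         (auto intro!: borel_measurable_max borel_measurable_diff measurable_component_singleton
               dest: measurable_nonnegD)
  qed
  have Q: "?Q s" if "s \<le> n + \<tau>"
  proof (cases "s < \<tau>")
    case True
    then show ?thesis
      by (simp add: order_qty.simps measurable_nonneg)
  next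
    case False
    have "(\<lambda>d. if i = 0 then (if \<tau> = 0 then prior_inv \<tau> A d s else inv_level \<tau> A d (s - \<tau>))
            else order_qty \<tau> A d (s - \<tau> + i)) \<in> Pi\<^sub>M {..<n} (\<lambda>_. borel) \<rightarrow>\<^sub>M restrict_space borel {0..}"
      if i: "i < max 1 \<tau>" for i
    proof -
      consider "i \<noteq> 0" "i < \<tau>" | "i = 0" "\<tau> = 0" | "i = 0" "\<tau> > 0"
        using i by (auto simp: max_def split: if_splits)
      then show ?thesis
      proof cases
        case 1
        then have "s - \<tau> + i < s" "s - \<tau> + i \<le> n + \<tau>"
          using \<open>s \<le> n + \<tau>\<close> False by auto
        then show ?thesis
          using less.IH[of "s - \<tau> + i"] 1 by simp
      next
        case 2
        then show ?thesis
          using P \<open>s \<le> n + \<tau>\<close> by simp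
      next
        case 3
        then have "s - \<tau> < s" "s - \<tau> \<le> n"
          using \<open>s \<le> n + \<tau>\<close> False by auto
        then show ?thesis
          using less.IH[of "s - \<tau>"] 3 by simp
      qed
    qed
    then have "(\<lambda>d. \<lambda>i\<in>{..<max 1 \<tau>}.
        if i = 0 then (if \<tau> = 0 then prior_inv \<tau> A d s else inv_level \<tau> A d (s - \<tau>))
            else order_qty \<tau> A d (s - \<tau> + i)) \<in> Pi\<^sub>M {..<n} (\<lambda>_. borel) \<rightarrow>\<^sub>M state_space \<tau>"
      unfolding state_space_def by (intro measurable_restrict) auto
    moreover have "A (s - \<tau>) \<in> state_space \<tau> \<rightarrow>\<^sub>M restrict_space borel {0..}"
      using A by (simp add: policies_def)
    ultimately show ?thesis
      using False unfolding order_qty.simps[of _ _ _ s]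
      by (auto intro: measurable_compose)
  qed
  have R: "?R s" if "s \<le> n"
    unfolding inv_level.simps[of _ _ _ s]
    using measurable_nonnegD[OF P[OF that]] measurable_nonnegD[OF Q] that
    by (intro measurable_nonneg borel_measurable_add) (auto intro!: add_nonneg_nonneg)
  show ?case
    using P Q R by blast
qed

lemma sys_state_cong:
  "(\<And>i. i < t \<Longrightarrow> d i = d' i) \<Longrightarrow> sys_state \<tau> A d t = sys_state \<tau> A d' t"
  unfolding sys_state_def by (intro restrict_ext) (auto simp: sample_path_cong[of t d d'])

lemma sys_state_measurable:
  assumes "A \<in> policies \<tau>"
  shows "(\<lambda>d. sys_state \<tau> A d t) \<in> Pi\<^sub>M {..<t} (\<lambda>_. borel) \<rightarrow>\<^sub>M state_space \<tau>"
proof -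
  have "(\<lambda>d. if i = 0 then (if \<tau> = 0 then prior_inv \<tau> A d t else inv_level \<tau> A d t)
          else order_qty \<tau> A d (t + i)) \<in> Pi\<^sub>M {..<t} (\<lambda>_. borel) \<rightarrow>\<^sub>M restrict_space borel {0..}"
    if "i \<in> {..<max 1 \<tau>}" for i
    using sample_path_measurable[OF assms, of t t] sample_path_measurable[OF assms, of "t + i" t] that
    by (cases "i = 0") auto
  then show ?thesis
    unfolding sys_state_def state_space_def by (intro measurable_restrict)
qed

lemma end_inv_eq_proj_end_inv:
  "prior_inv \<tau> A d (t + \<tau>) = proj_end_inv \<tau> (sys_state \<tau> A d t) (\<lambda>k. d (t + k))"
proof -
  have "k < \<tau> \<Longrightarrow> proj_inv (sys_state \<tau> A d t) (\<lambda>k. d (t + k)) k = inv_level \<tau> A d (t + k)" for k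
  proof (induction k)
    case (Suc k)
    then show ?case
      using inv_level.simps[of \<tau> A d "t + Suc k"] prior_inv.simps[of \<tau> A d "t + Suc k"]
      by (simp add: sys_state_def)
  qed (simp add: sys_state_def)
  then show ?thesis
    using prior_inv.simps[of \<tau> A d "t + \<tau>"]
    by (cases "\<tau> = 0") (auto simp: proj_end_inv_def sys_state_def)
qed

lemma proj_inv_cong: "(\<And>i. i < k \<Longrightarrow> e i = e' i) \<Longrightarrow> proj_inv x e k = proj_inv x e' k"
  by (induction k) auto

lemma proj_end_inv_cong: "(\<And>i. i < \<tau> \<Longrightarrow> e i = e' i) \<Longrightarrow> proj_end_inv \<tau> x e = proj_end_inv \<tau> x e'"
  using proj_inv_cong[of "\<tau> - 1" e e' x] by (auto simp: proj_end_inv_def)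

lemma state_space_nth:
  assumes "i < max 1 \<tau>"
  shows "(\<lambda>x. x i) \<in> borel_measurable (state_space \<tau>)" "x \<in> space (state_space \<tau>) \<Longrightarrow> x i \<ge> 0"
proof -
  have "(\<lambda>x. x i) \<in> state_space \<tau> \<rightarrow>\<^sub>M restrict_space borel {0..}"
    unfolding state_space_def using assms by (intro measurable_component_singleton) auto
  then show "(\<lambda>x. x i) \<in> borel_measurable (state_space \<tau>)" "x \<in> space (state_space \<tau>) \<Longrightarrow> x i \<ge> 0"
    by (auto dest: measurable_nonnegD)
qed

lemma proj_end_inv_measurable:
  "(\<lambda>(x, e). proj_end_inv \<tau> x e) \<in> borel_measurable (state_space \<tau> \<Otimes>\<^sub>M Pi\<^sub>M {..<\<tau>} (\<lambda>_. borel))"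
proof -
  have x: "(\<lambda>z. fst z i) \<in> borel_measurable (state_space \<tau> \<Otimes>\<^sub>M Pi\<^sub>M {..<\<tau>} (\<lambda>_. borel))"
    if "i < max 1 \<tau>" for i
    by (rule measurable_compose[OF measurable_fst state_space_nth(1)[OF that]])
  have e: "(\<lambda>z. snd z i) \<in> borel_measurable (state_space \<tau> \<Otimes>\<^sub>M Pi\<^sub>M {..<\<tau>} (\<lambda>_. borel))"
    if "i < \<tau>" for i
    using that by (intro measurable_compose[OF measurable_snd] measurable_component_singleton) auto
  have p: "k < max 1 \<tau> \<Longrightarrow>
      (\<lambda>z. proj_inv (fst z) (snd z) k) \<in> borel_measurable (state_space \<tau> \<Otimes>\<^sub>M Pi\<^sub>M {..<\<tau>} (\<lambda>_. borel))" for k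
    by (induction k) (auto intro!: x e borel_measurable_add borel_measurable_max borel_measurable_diff)
  show ?thesis
    unfolding case_prod_beta proj_end_inv_def
    using x[of 0] by (cases "\<tau> = 0") (auto intro!: e p borel_measurable_max borel_measurable_diff)
qed

lemma proj_end_inv_bounds:
  assumes x: "x \<in> space (state_space \<tau>)" and e: "\<And>i. i < \<tau> \<Longrightarrow> e i \<ge> 0"
  shows "0 \<le> proj_end_inv \<tau> x e" "proj_end_inv \<tau> x e \<le> (\<Sum>i<max 1 \<tau>. x i)"
proof -
  have p: "k < max 1 \<tau> \<Longrightarrow> proj_inv x e k \<le> (\<Sum>i\<le>k. x i)" for k
  proof (induction k)
    case (Suc k)
    moreover have "0 \<le> (\<Sum>i\<le>k. x i)"
      using Suc.prems by (intro sum_nonneg state_space_nth(2)[OF _ x]) auto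
    moreover have "k < max 1 \<tau>" "e k \<ge> 0" using Suc.prems by (auto intro: e)
    ultimately show ?case by fastforce
  qed simp
  show "0 \<le> proj_end_inv \<tau> x e"
    using state_space_nth(2)[OF _ x, of 0] by (auto simp: proj_end_inv_def)
  show "proj_end_inv \<tau> x e \<le> (\<Sum>i<max 1 \<tau>. x i)"
  proof (cases "\<tau> = 0")
    case False
    then have "{..<max 1 \<tau>} = {..\<tau> - 1}" by auto
    moreover have "0 \<le> (\<Sum>i<max 1 \<tau>. x i)"
      by (intro sum_nonneg state_space_nth(2)[OF _ x]) auto
    ultimately show ?thesis
      using p[of "\<tau> - 1"] e[of "\<tau> - 1"] False by (auto simp: proj_end_inv_def)
  qed (simp add: proj_end_inv_def)
qed

lemma proj_end_inv_nonneg: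
  "x \<in> space (state_space \<tau>) \<Longrightarrow> 0 \<le> proj_end_inv \<tau> x e"
  using state_space_nth(2)[of 0 \<tau> x] by (auto simp: proj_end_inv_def)

text \<open>Here \<open>prior_inv \<tau> A _ (t + \<tau>)\<close> is \<open>J\<^bsub>t+\<tau>-1\<^esub>\<close>.\<close>

lemma nn_cond_exp_end_inv:
  fixes M :: "'a measure" and D :: "nat \<Rightarrow> 'a \<Rightarrow> real" and t :: nat
  assumes "prob_space M"
    and ind: "prob_space.indep_vars M (\<lambda>_. borel) D UNIV"
    and nonneg: "\<And>t. AE \<omega> in M. D t \<omega> \<ge> 0"
    and A: "A \<in> policies \<tau>"
  defines "X \<equiv> (\<lambda>\<omega>. sys_state \<tau> A (\<lambda>s. D s \<omega>) t)"
  shows "AE \<omega> in M. ennreal (expected_end_inv M D \<tau> t (X \<omega>)) =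
    nn_cond_exp M (vimage_algebra (space M) X (state_space \<tau>))
      (\<lambda>\<omega>. ennreal (prior_inv \<tau> A (\<lambda>s. D s \<omega>) (t + \<tau>))) \<omega>"
proof -
  interpret prob_space M by fact
  define E where "E = (Pi\<^sub>M {..<\<tau>} (\<lambda>_. borel) :: (nat \<Rightarrow> real) measure)"
  define Y where "Y = (\<lambda>\<omega>. \<lambda>k\<in>{..<\<tau>}. D (t + k) \<omega>)"
  define S where "S = state_space \<tau>"
  define F where "F = vimage_algebra (space M) X S"
  define f where "f = (\<lambda>x e. ennreal (proj_end_inv \<tau> x e))"
  have f [measurable]: "case_prod f \<in> borel_measurable (S \<Otimes>\<^sub>M E)"
    using measurable_compose[OF proj_end_inv_measurable measurable_ennreal]
    by (simp add: f_def S_def E_def case_prod_beta)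
  have "indep_var (Pi\<^sub>M {..<t} (\<lambda>_. borel)) (\<lambda>\<omega>. \<lambda>s\<in>{..<t}. D s \<omega>)
      (Pi\<^sub>M {t..<t + \<tau>} (\<lambda>_. borel)) (\<lambda>\<omega>. \<lambda>s\<in>{t..<t + \<tau>}. D s \<omega>)"
    by (rule indep_var_restrict[OF ind]) auto
  moreover have "(\<lambda>e. \<lambda>k\<in>{..<\<tau>}. e (t + k)) \<in> Pi\<^sub>M {t..<t + \<tau>} (\<lambda>_. borel) \<rightarrow>\<^sub>M E"
    unfolding E_def by (intro measurable_restrict measurable_component_singleton) auto
  ultimately have "indep_var S ((\<lambda>d. sys_state \<tau> A d t) \<circ> (\<lambda>\<omega>. \<lambda>s\<in>{..<t}. D s \<omega>))
      E ((\<lambda>e. \<lambda>k\<in>{..<\<tau>}. e (t + k)) \<circ> (\<lambda>\<omega>. \<lambda>s\<in>{t..<t + \<tau>}. D s \<omega>))"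
    unfolding S_def by (rule indep_var_compose[OF _ sys_state_measurable[OF A]])
  moreover have "(\<lambda>d. sys_state \<tau> A d t) \<circ> (\<lambda>\<omega>. \<lambda>s\<in>{..<t}. D s \<omega>) = X"
    by (auto simp: fun_eq_iff X_def intro!: fun_cong[OF sys_state_cong])
  moreover have "(\<lambda>e. \<lambda>k\<in>{..<\<tau>}. e (t + k)) \<circ> (\<lambda>\<omega>. \<lambda>s\<in>{t..<t + \<tau>}. D s \<omega>) = Y"
    by (auto simp: fun_eq_iff Y_def)
  ultimately have indXY: "indep_var S X E Y" by simp
  then have X [measurable]: "X \<in> M \<rightarrow>\<^sub>M S" and Y [measurable]: "Y \<in> M \<rightarrow>\<^sub>M E"
    and joint: "distr M S X \<Otimes>\<^sub>M distr M E Y = distr M (S \<Otimes>\<^sub>M E) (\<lambda>\<omega>. (X \<omega>, Y \<omega>))"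
    by (auto simp: indep_var_distribution_eq)
  interpret DX: prob_space "distr M S X" by (rule prob_space_distr[OF X])
  interpret DY: prob_space "distr M E Y" by (rule prob_space_distr[OF Y])
  have g [measurable]: "(\<lambda>x. \<integral>\<^sup>+e. f x e \<partial>distr M E Y) \<in> borel_measurable S"
    by (intro DY.borel_measurable_nn_integral) simp
  have fY: "f x (Y \<omega>) = ennreal (proj_end_inv \<tau> x (\<lambda>k. D (t + k) \<omega>))" for x \<omega>
    unfolding f_def Y_def by (intro arg_cong[where f = ennreal] proj_end_inv_cong) auto
  have g_eq: "(\<integral>\<^sup>+e. f x e \<partial>distr M E Y) = ennreal (expected_end_inv M D \<tau> t x)"
    if x: "x \<in> space S" for x
  proof -
    have [measurable]: "f x \<in> borel_measurable E"
      using measurable_Pair2[OF f x] by simp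
    have "(\<lambda>e. proj_end_inv \<tau> x e) \<in> borel_measurable E"
      using measurable_Pair2[OF proj_end_inv_measurable x[unfolded S_def]] by (simp add: E_def)
    from measurable_compose[OF Y this]
    have "(\<lambda>\<omega>. proj_end_inv \<tau> x (Y \<omega>)) \<in> borel_measurable M" .
    also have "(\<lambda>\<omega>. proj_end_inv \<tau> x (Y \<omega>)) = (\<lambda>\<omega>. proj_end_inv \<tau> x (\<lambda>k. D (t + k) \<omega>))"
      unfolding Y_def by (intro ext proj_end_inv_cong) auto
    finally have m: "(\<lambda>\<omega>. proj_end_inv \<tau> x (\<lambda>k. D (t + k) \<omega>)) \<in> borel_measurable M" .
    have "AE \<omega> in M. \<forall>k. D (t + k) \<omega> \<ge> 0"
      using nonneg by (auto simp: AE_all_countable)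
    then have "AE \<omega> in M. norm (proj_end_inv \<tau> x (\<lambda>k. D (t + k) \<omega>)) \<le> (\<Sum>i<max 1 \<tau>. x i)"
      by eventually_elim (use x proj_end_inv_bounds[of x \<tau>] in \<open>auto simp: S_def\<close>)
    then have "integrable M (\<lambda>\<omega>. proj_end_inv \<tau> x (\<lambda>k. D (t + k) \<omega>))"
      by (intro integrable_const_bound m)
    then show ?thesis
      using x by (simp add: nn_integral_distr fY expected_end_inv_def nn_integral_eq_integral
          S_def proj_end_inv_nonneg)
  qed
  have sub: "subalgebra M F"
    unfolding F_def subalgebra_def using X by (auto simp: measurable_iff_sets)
  interpret finite_measure_subalgebra M F
    by unfold_locales (rule sub)
  have XF [measurable]: "X \<in> F \<rightarrow>\<^sub>M S"
    unfolding F_def using measurable_space[OF X] by (intro measurable_vimage_algebra1) auto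
  have "AE \<omega> in M. (\<integral>\<^sup>+e. f (X \<omega>) e \<partial>distr M E Y) = nn_cond_exp M F (\<lambda>\<omega>. f (X \<omega>) (Y \<omega>)) \<omega>"
  proof (rule nn_cond_exp_charact)
    fix B assume "B \<in> sets F"
    then obtain C where C [measurable]: "C \<in> sets S" and B: "B = X -` C \<inter> space M"
      using measurable_space[OF X] unfolding F_def by (auto simp: sets_vimage_algebra2)
    have ind_eq: "indicator B \<omega> = (indicator C (X \<omega>) :: ennreal)" if "\<omega> \<in> space M" for \<omega>
      using that by (auto simp: B indicator_def)
    have "(\<lambda>z. case_prod f z * indicator C (fst z)) \<in> borel_measurable (S \<Otimes>\<^sub>M E)"
      by measurable
    moreover have "sets (distr M S X \<Otimes>\<^sub>M distr M E Y) = sets (S \<Otimes>\<^sub>M E)"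
      by (intro sets_pair_measure_cong) simp_all
    ultimately have meas: "(\<lambda>z. case_prod f z * indicator C (fst z))
        \<in> borel_measurable (distr M S X \<Otimes>\<^sub>M distr M E Y)"
      by (simp cong: measurable_cong_sets)
    have "(\<integral>\<^sup>+\<omega>\<in>B. f (X \<omega>) (Y \<omega>) \<partial>M) = (\<integral>\<^sup>+\<omega>. f (X \<omega>) (Y \<omega>) * indicator C (X \<omega>) \<partial>M)"
      by (intro nn_integral_cong) (simp add: ind_eq)
    also have "\<dots> = (\<integral>\<^sup>+z. case_prod f z * indicator C (fst z)
        \<partial>distr M (S \<Otimes>\<^sub>M E) (\<lambda>\<omega>. (X \<omega>, Y \<omega>)))"
      by (subst nn_integral_distr) auto
    also have "\<dots> = (\<integral>\<^sup>+x. \<integral>\<^sup>+e. f x e * indicator C x \<partial>distr M E Y \<partial>distr M S X)"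
      unfolding joint[symmetric]
      by (subst DY.nn_integral_fst[symmetric]) (auto simp: meas)
    also have "\<dots> = (\<integral>\<^sup>+x. (\<integral>\<^sup>+e. f x e \<partial>distr M E Y) * indicator C x \<partial>distr M S X)"
      using measurable_Pair2[OF f] by (intro nn_integral_cong nn_integral_multc) simp
    also have "\<dots> = (\<integral>\<^sup>+\<omega>. (\<integral>\<^sup>+e. f (X \<omega>) e \<partial>distr M E Y) * indicator C (X \<omega>) \<partial>M)"
      by (subst nn_integral_distr) auto
    also have "\<dots> = (\<integral>\<^sup>+\<omega>\<in>B. (\<integral>\<^sup>+e. f (X \<omega>) e \<partial>distr M E Y) \<partial>M)"
      by (intro nn_integral_cong) (simp add: ind_eq)
    finally show "(\<integral>\<^sup>+\<omega>\<in>B. f (X \<omega>) (Y \<omega>) \<partial>M) = \<dots>" .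
  next
    show "(\<lambda>\<omega>. f (X \<omega>) (Y \<omega>)) \<in> borel_measurable M"
      using measurable_compose[OF measurable_Pair[OF X Y] f] by simp
    show "(\<lambda>\<omega>. \<integral>\<^sup>+e. f (X \<omega>) e \<partial>distr M E Y) \<in> borel_measurable F"
      by (rule measurable_compose[OF XF g])
  qed
  moreover have "f (X \<omega>) (Y \<omega>) = ennreal (prior_inv \<tau> A (\<lambda>s. D s \<omega>) (t + \<tau>))" for \<omega>
    by (simp add: fY end_inv_eq_proj_end_inv X_def)
  ultimately have "AE \<omega> in M. (\<integral>\<^sup>+e. f (X \<omega>) e \<partial>distr M E Y) =
      nn_cond_exp M F (\<lambda>\<omega>. ennreal (prior_inv \<tau> A (\<lambda>s. D s \<omega>) (t + \<tau>))) \<omega>"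
    by simp
  then show ?thesis
    using AE_space unfolding F_def S_def[symmetric]
    by eventually_elim (simp add: g_eq[symmetric] measurable_space[OF X])
qed

end

theory Submission
  imports Defs
begin

text \<open>
  Under exponential demand the lost sales \<open>L\<close> of a period are memoryless, so that
  \<open>E[L\<^sup>2] = 2 \<mu> E[L]\<close>, and the Poisson equation of \<open>C\<^sup>r\<close> has a quadratic solution with average cost
  \<open>g(r) = h r\<^sup>2 / (2 (\<mu> - r)) + p (\<mu> - r)\<close>.  The PIL policy with \<open>U(r) = p (\<mu> - r) / h\<close> is the policy
  improvement of \<open>C\<^sup>r\<close> with respect to this solution, hence its cost-rate is at most \<open>g(r)\<close>.

  For a lower bound on all policies, note that the orders arriving in the periods
  \<open>t, \<dots>, t + \<tau>\<close> are independent of the demands in these periods and that \<open>J\<^bsub>t+\<tau>\<^esub>\<close> is convex in these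
  orders.  By Jensen's inequality the cost-rate is at least the minimum over \<open>r \<in> [0, \<mu>]\<close> of
  \<open>h \<phi>\<^bsub>\<tau>+1\<^esub>(r) + p (\<mu> - r)\<close>, where \<open>\<phi>\<^bsub>n\<^esub>(r)\<close> is the mean inventory after \<open>n\<close> periods with constant
  orders \<open>r\<close>, starting empty.  As \<open>\<phi>\<^bsub>n\<^esub>(r)\<close> increases to \<open>r\<^sup>2 / (2 (\<mu> - r))\<close>, this minimum tends to the
  minimum of \<open>g\<close>.
\<close>

text \<open>No stationary distribution is constructed. Costs telescope against the bias over a
  finite horizon, and only the expected bias at the horizon has to be controlled. Being a parabola,
  the bias is bounded below, which suffices for an upper bound on the PIL cost without any stability
  analysis of that policy. The hypothesis on \<open>rstar\<close> speaks of cost-rates, so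
  \<open>C(C^r) = g(r)\<close> is needed exactly, and this takes a two-sided bound: an exponential
  moment of the inventory, uniform in time.

  The lower bound has to cover unbounded, time-dependent policies with possibly infinite expected
  costs. Jensen's inequality therefore appears as a subgradient inequality at a deterministic order
  \<open>r\<close>, summed over time; only the total expected order then remains of the policy. The
  pole of \<open>g\<close> at \<mu> rules out uniform convergence of \<open>\<phi>\<^sub>n\<close>
  on \<open>[0, \<mu>)\<close>; monotonicity in \<open>r\<close> takes its place.\<close>

section \<open>Exponential demand: moments and memorylessness\<close>

locale exponential_demand = prob_space M for M :: "'a measure" +
  fixes D :: "nat \<Rightarrow> 'a \<Rightarrow> real" and \<mu> :: real
  assumes mean_pos: "\<mu> > 0"
    and indep: "indep_vars (\<lambda>_. borel) D UNIV"
    and distr_D: "\<And>t. distributed M lborel (D t) (exponential_density (1 / \<mu>))"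
begin

lemma demand_measurable [measurable]: "D t \<in> borel_measurable M"
  using distributed_measurable[OF distr_D] by simp

lemma demand_integrable_power: "integrable M (\<lambda>\<omega>. D t \<omega> ^ k)"
  using erlang_ith_moment_integrable[OF _ distr_D] mean_pos by simp

lemma demand_integrable: "integrable M (D t)"
  using demand_integrable_power[of t 1] by simp

lemma expectation_demand: "expectation (D t) = \<mu>"
  using erlang_ith_moment[OF _ distr_D[of t], of 1] mean_pos by simp

lemma expectation_demand_square: "expectation (\<lambda>\<omega>. (D t \<omega>)\<^sup>2) = 2 * \<mu>\<^sup>2"
  using erlang_ith_moment[OF _ distr_D[of t], of 2] mean_pos by (simp add: power_divide)

lemma AE_demand_nonneg: "AE \<omega> in M. \<forall>t. D t \<omega> \<ge> 0"
proof -
  have "AE \<omega> in M. D t \<omega> \<ge> 0" for t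
    by (subst distributed_AE2[OF distr_D]) (auto simp: erlang_density_def)
  then show ?thesis by (simp add: AE_all_countable)
qed

text \<open>Memorylessness: on the positive half-line the density shifted by \<open>x\<close> is
  \<open>exp (- x / \<mu>)\<close> times the original one. The power must be positive so that the
  negative half-line contributes 0.\<close>

lemma expectation_excess_power:
  assumes x: "x \<ge> 0" and k: "k > 0"
  shows "expectation (\<lambda>\<omega>. max 0 (D t \<omega> - x) ^ k) = exp (- x / \<mu>) * expectation (\<lambda>\<omega>. D t \<omega> ^ k)"
proof -
  let ?f = "exponential_density (1 / \<mu>)"
  have f: "?f y \<ge> 0" for y
    using mean_pos by (simp add: exponential_density_nonneg)
  have "expectation (\<lambda>\<omega>. max 0 (D t \<omega> - x) ^ k) = (\<integral>y. ?f y * max 0 (y - x) ^ k \<partial>lborel)"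
    by (rule distributed_integral[OF distr_D, symmetric]) (auto simp: f)
  also have "\<dots> = (\<integral>u. ?f (x + u) * max 0 u ^ k \<partial>lborel)"
    by (subst lborel_integral_real_affine[of 1 _ x]) auto
  also have "\<dots> = (\<integral>u. exp (- x / \<mu>) * (?f u * max 0 u ^ k) \<partial>lborel)"
    using x k by (intro Bochner_Integration.integral_cong)
      (auto simp: erlang_density_def exp_add[symmetric] add_divide_distrib max_def)
  also have "\<dots> = exp (- x / \<mu>) * expectation (\<lambda>\<omega>. max 0 (D t \<omega>) ^ k)"
    using distributed_integral[OF distr_D, of "\<lambda>u. max 0 u ^ k"] f by simp
  also have "expectation (\<lambda>\<omega>. max 0 (D t \<omega>) ^ k) = expectation (\<lambda>\<omega>. D t \<omega> ^ k)"
    using AE_demand_nonneg by (intro integral_cong_AE) (auto elim!: eventually_mono simp: max_def)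
  finally show ?thesis .
qed

text \<open>The factor \<open>exp (- \<theta> * y)\<close> turns the density into a multiple of the
  one with rate \<open>\<theta> + 1 / \<mu>\<close>, whose total mass is 1. This Laplace transform
  supplies the contraction factor for the exponential moments of the inventory.\<close>

lemma expectation_exp_demand:
  assumes "\<theta> \<ge> 0"
  shows "integrable M (\<lambda>\<omega>. exp (- \<theta> * D t \<omega>))"
    and "expectation (\<lambda>\<omega>. exp (- \<theta> * D t \<omega>)) = 1 / (1 + \<theta> * \<mu>)"
proof -
  let ?l = "\<theta> + 1 / \<mu>"
  have l: "?l > 0" using assms mean_pos by (simp add: add_nonneg_pos)
  show "integrable M (\<lambda>\<omega>. exp (- \<theta> * D t \<omega>))"
    using AE_demand_nonneg assms
    by (intro integrable_const_bound[of _ 1]) (auto elim!: eventually_mono)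
  have "expectation (\<lambda>\<omega>. exp (- \<theta> * D t \<omega>)) =
      (\<integral>y. exponential_density (1 / \<mu>) y * exp (- \<theta> * y) \<partial>lborel)"
    using mean_pos by (intro distributed_integral[OF distr_D, symmetric])
      (auto simp: exponential_density_nonneg)
  also have "\<dots> = (\<integral>y. 1 / (1 + \<theta> * \<mu>) * exponential_density ?l y \<partial>lborel)"
  proof (intro Bochner_Integration.integral_cong refl)
    have e: "1 / (1 + \<theta> * \<mu>) * ?l = 1 / \<mu>"
    proof -
      have "1 + \<theta> * \<mu> > 0" using mean_pos assms by (simp add: add_pos_nonneg)
      moreover have "?l = (1 + \<theta> * \<mu>) / \<mu>" using mean_pos by (simp add: field_simps)
      ultimately show ?thesis by simp
    qed
    show "exponential_density (1 / \<mu>) y * exp (- \<theta> * y) = 1 / (1 + \<theta> * \<mu>) * exponential_density ?l y" for y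
    proof (cases "y < 0")
      case False
      have "exponential_density (1 / \<mu>) y * exp (- \<theta> * y) = 1 / \<mu> * exp (- y * ?l)"
        using False by (simp add: exponential_density_def exp_add[symmetric] algebra_simps)
      also have "\<dots> = (1 / (1 + \<theta> * \<mu>) * ?l) * exp (- y * ?l)"
        by (simp only: e)
      also have "\<dots> = 1 / (1 + \<theta> * \<mu>) * exponential_density ?l y"
        using False by (simp add: exponential_density_def)
      finally show ?thesis .
    qed (simp add: exponential_density_def)
  qed
  also have "\<dots> = 1 / (1 + \<theta> * \<mu>) * (\<integral>y. exponential_density ?l y \<partial>lborel)"
    by simp
  also have "(\<integral>y. exponential_density ?l y \<partial>lborel) = 1"
  proof -
    interpret L: prob_space "density lborel (exponential_density ?l)"
      by (rule prob_space_exponential_density[OF l])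
    have "(\<integral>y. exponential_density ?l y * 1 \<partial>lborel) = (\<integral>y. 1 \<partial>density lborel (exponential_density ?l))"
      using l by (subst integral_density) (auto simp: exponential_density_nonneg)
    also have "\<dots> = 1" using L.prob_space by simp
    finally show ?thesis by simp
  qed
  finally show "expectation (\<lambda>\<omega>. exp (- \<theta> * D t \<omega>)) = 1 / (1 + \<theta> * \<mu>)" by simp
qed

text \<open>Fubini's theorem for the product law of \<open>X\<close> and \<open>Y\<close>. It
  freezes \<open>X\<close>, so that identities for a fixed inventory level can be averaged over a
  random one.\<close>

lemma expectation_indep_pair:
  assumes ind: "indep_var borel X borel Y" and f: "case_prod f \<in> borel_measurable (borel \<Otimes>\<^sub>M borel)"
    and int: "integrable M (\<lambda>\<omega>. f (X \<omega>) (Y \<omega>) :: real)"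
  shows "expectation (\<lambda>\<omega>. f (X \<omega>) (Y \<omega>)) = expectation (\<lambda>\<omega>. expectation (\<lambda>\<omega>'. f (X \<omega>) (Y \<omega>')))"
proof -
  have X [measurable]: "X \<in> borel_measurable M" and Y [measurable]: "Y \<in> borel_measurable M"
    and joint: "distr M borel X \<Otimes>\<^sub>M distr M borel Y = distr M (borel \<Otimes>\<^sub>M borel) (\<lambda>\<omega>. (X \<omega>, Y \<omega>))"
    using ind by (auto simp: indep_var_distribution_eq)
  interpret X: prob_space "distr M borel X" by (rule prob_space_distr[OF X])
  interpret Y: prob_space "distr M borel Y" by (rule prob_space_distr[OF Y])
  interpret XY: pair_prob_space "distr M borel X" "distr M borel Y" ..
  note f [measurable]
  have fx [measurable]: "f x \<in> borel_measurable borel" for x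
    using measurable_Pair2[OF f, of x] by simp
  have sets: "sets (distr M borel X \<Otimes>\<^sub>M distr M borel Y) = sets (borel \<Otimes>\<^sub>M borel)"
    by (intro sets_pair_measure_cong) simp_all
  have i: "integrable (distr M borel X \<Otimes>\<^sub>M distr M borel Y) (case_prod f)"
    unfolding joint using int by (subst integrable_distr_eq) auto
  have "expectation (\<lambda>\<omega>. f (X \<omega>) (Y \<omega>)) = (\<integral>z. case_prod f z \<partial>(distr M borel X \<Otimes>\<^sub>M distr M borel Y))"
    unfolding joint by (subst integral_distr) auto
  also have "\<dots> = (\<integral>x. (\<integral>y. f x y \<partial>distr M borel Y) \<partial>distr M borel X)"
    using XY.integral_fst[of f] i by simp
  also have "\<dots> = expectation (\<lambda>\<omega>. \<integral>y. f (X \<omega>) y \<partial>distr M borel Y)"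
    by (rule integral_distr) (auto intro!: Y.borel_measurable_lebesgue_integral)
  also have "\<dots> = expectation (\<lambda>\<omega>. expectation (\<lambda>\<omega>'. f (X \<omega>) (Y \<omega>')))"
    by (simp add: integral_distr)
  finally show ?thesis .
qed

text \<open>At a fixed level \<open>x\<close> the first two moments of the lost sales carry the same
  factor \<open>exp (- x / \<mu>)\<close>, so their ratio is that of the demand moments
  \<open>2 * \<mu>\<^sup>2\<close> and \<open>\<mu>\<close>. Integrability holds because lost sales
  are at most the demand.\<close>

lemma
  assumes ind: "indep_var borel X borel (D t)" and nonneg: "AE \<omega> in M. 0 \<le> X \<omega>"
  shows integrable_excess: "integrable M (\<lambda>\<omega>. max 0 (D t \<omega> - X \<omega>))"
    and integrable_excess_square: "integrable M (\<lambda>\<omega>. (max 0 (D t \<omega> - X \<omega>))\<^sup>2)"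
    and expectation_excess_square:
      "expectation (\<lambda>\<omega>. (max 0 (D t \<omega> - X \<omega>))\<^sup>2) = 2 * \<mu> * expectation (\<lambda>\<omega>. max 0 (D t \<omega> - X \<omega>))"
proof -
  let ?L = "\<lambda>x y::real. max 0 (y - x)"
  have X [measurable]: "X \<in> borel_measurable M"
    using indep_var_rv1[OF ind] .
  have bnd: "AE \<omega> in M. ?L (X \<omega>) (D t \<omega>) \<le> D t \<omega>"
    using nonneg AE_demand_nonneg by eventually_elim (metis diff_ge_0_iff_ge diff_le_eq le_add_same_cancel1 max.boundedI)
  show i1: "integrable M (\<lambda>\<omega>. ?L (X \<omega>) (D t \<omega>))"
    using bnd by (intro Bochner_Integration.integrable_bound[OF demand_integrable[of t]]) auto
  show i2: "integrable M (\<lambda>\<omega>. (?L (X \<omega>) (D t \<omega>))\<^sup>2)"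
  proof (rule Bochner_Integration.integrable_bound[OF demand_integrable_power[of t 2]])
    show "AE \<omega> in M. norm ((?L (X \<omega>) (D t \<omega>))\<^sup>2) \<le> norm ((D t \<omega>)\<^sup>2)"
      using bnd by eventually_elim (auto intro!: power_mono)
  qed simp
  have inner: "expectation (\<lambda>\<omega>. (?L x (D t \<omega>))\<^sup>2 - 2 * \<mu> * ?L x (D t \<omega>)) = 0" if x: "x \<ge> 0" for x
  proof -
    have "AE \<omega> in M. ?L x (D t \<omega>) \<le> D t \<omega>"
      using AE_demand_nonneg by eventually_elim (use x in auto)
    then have "integrable M (\<lambda>\<omega>. ?L x (D t \<omega>))" "integrable M (\<lambda>\<omega>. (?L x (D t \<omega>))\<^sup>2)"
      by (intro Bochner_Integration.integrable_bound[OF demand_integrable[of t]]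
          Bochner_Integration.integrable_bound[OF demand_integrable_power[of t 2]];
          auto elim!: eventually_mono intro!: power_mono)+
    then show ?thesis
      using expectation_excess_power[OF x, of 1 t] expectation_excess_power[OF x, of 2 t]
      using expectation_demand_square[of t] expectation_demand[of t] by (simp add: power2_eq_square[of \<mu>])
  qed
  have "expectation (\<lambda>\<omega>. (?L (X \<omega>) (D t \<omega>))\<^sup>2 - 2 * \<mu> * ?L (X \<omega>) (D t \<omega>)) =
      expectation (\<lambda>\<omega>. expectation (\<lambda>\<omega>'. (?L (X \<omega>) (D t \<omega>'))\<^sup>2 - 2 * \<mu> * ?L (X \<omega>) (D t \<omega>')))"
    using i1 i2 by (intro expectation_indep_pair[OF ind, where f = "\<lambda>x y. (?L x y)\<^sup>2 - 2 * \<mu> * ?L x y"]) auto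
  also have "\<dots> = 0"
    using nonneg by (intro integral_eq_zero_AE) (auto elim!: eventually_mono simp: inner)
  finally show "expectation (\<lambda>\<omega>. (?L (X \<omega>) (D t \<omega>))\<^sup>2) = 2 * \<mu> * expectation (\<lambda>\<omega>. ?L (X \<omega>) (D t \<omega>))"
    using i1 i2 by simp
qed

end

section \<open>Sample-path bounds on orders and inventories\<close>

lemma order_qty_eq_policy: "order_qty \<tau> A d (t + \<tau>) = A t (sys_state \<tau> A d t)"
  by (simp add: order_qty.simps[of _ _ _ "t + \<tau>"] sys_state_def cong: if_cong)

text \<open>Measurability is known on the finite product of the first \<open>t\<close> demands only,
  whose elements are extensional functions. Restricting the path to these indices enters that space
  and leaves the state unchanged.\<close>

lemma sys_state_in_space:
  assumes "A \<in> policies \<tau>"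
  shows "sys_state \<tau> A d t \<in> space (state_space \<tau>)"
proof -
  have "sys_state \<tau> A (restrict d {..<t}) t \<in> space (state_space \<tau>)"
    by (rule measurable_space[OF sys_state_measurable[OF assms]]) (auto simp: space_PiM)
  also have "sys_state \<tau> A (restrict d {..<t}) t = sys_state \<tau> A d t"
    by (rule sys_state_cong) simp
  finally show ?thesis .
qed

lemma policy_nonneg:
  assumes "A \<in> policies \<tau>" "x \<in> space (state_space \<tau>)"
  shows "A t x \<ge> 0"
  using assms by (intro measurable_nonnegD(2)[of "A t" "state_space \<tau>"]) (auto simp: policies_def)

lemma order_qty_nonneg:
  assumes "A \<in> policies \<tau>"
  shows "order_qty \<tau> A d s \<ge> 0"
proof (cases "s < \<tau>")
  case False
  then have "order_qty \<tau> A d s = A (s - \<tau>) (sys_state \<tau> A d (s - \<tau>))"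
    using order_qty_eq_policy[of \<tau> A d "s - \<tau>"] by simp
  then show ?thesis
    using policy_nonneg[OF assms sys_state_in_space[OF assms]] by simp
qed (simp add: order_qty.simps)

lemma prior_inv_nonneg: "prior_inv \<tau> A d s \<ge> 0"
  by (subst prior_inv.simps) simp

lemma inv_level_nonneg: "A \<in> policies \<tau> \<Longrightarrow> inv_level \<tau> A d s \<ge> 0"
  by (subst inv_level.simps) (simp add: prior_inv_nonneg order_qty_nonneg)

lemma prior_inv_0: "prior_inv \<tau> A d 0 = 0"
  by (simp add: prior_inv.simps)

lemma prior_inv_Suc: "prior_inv \<tau> A d (Suc s) = max 0 (prior_inv \<tau> A d s + order_qty \<tau> A d s - d s)"
  by (subst prior_inv.simps) (simp add: inv_level.simps[of _ _ _ s])

lemma end_inv_eq: "end_inv \<tau> A d s = prior_inv \<tau> A d (Suc s)"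
  by (simp add: end_inv_def prior_inv_Suc inv_level.simps[of _ _ _ s])

text \<open>Nothing arrives before period \<open>\<tau>\<close>. Costs are counted from period
  \<open>\<tau>\<close> on, so the telescoping sums start at bias 0.\<close>

lemma prior_inv_initial:
  assumes "\<And>i. d i \<ge> 0" "s \<le> \<tau>"
  shows "prior_inv \<tau> A d s = 0"
  using assms(2)
proof (induction s)
  case (Suc s)
  then show ?case
    using assms(1)[of s] by (simp add: prior_inv_Suc order_qty.simps[of \<tau> A d s])
qed (simp add: prior_inv_0)

lemma order_qty_le:
  assumes "A \<in> policies \<tau>" "B \<ge> 0" "\<forall>t. \<forall>x\<in>space (state_space \<tau>). A t x \<le> B"
  shows "order_qty \<tau> A d s \<le> B"
proof (cases "s < \<tau>")
  case False
  then have "order_qty \<tau> A d s = A (s - \<tau>) (sys_state \<tau> A d (s - \<tau>))"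
    using order_qty_eq_policy[of \<tau> A d "s - \<tau>"] by simp
  then show ?thesis
    using assms(3) sys_state_in_space[OF assms(1)] by simp
qed (simp add: order_qty.simps assms)

text \<open>The bound grows with time; it only secures integrability in each single period.\<close>

lemma prior_inv_le:
  assumes "A \<in> policies \<tau>" "B \<ge> 0" "\<forall>t. \<forall>x\<in>space (state_space \<tau>). A t x \<le> B"
    and d: "\<And>i. d i \<ge> 0"
  shows "prior_inv \<tau> A d s \<le> real s * B"
proof (induction s)
  case (Suc s)
  then show ?case
    using order_qty_le[OF assms(1-3), of d s] d[of s] \<open>B \<ge> 0\<close>
    by (auto simp: prior_inv_Suc algebra_simps)
qed (simp add: prior_inv_0)

lemma const_policy_in_policies: "r \<ge> 0 \<Longrightarrow> const_policy r \<in> policies \<tau>"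
  by (auto simp: policies_def const_policy_def space_restrict_space)

text \<open>
  The average cost under \<open>const_policy r\<close> and the associated bias (relative value) function of the
  end-of-period inventory, i.e. the solution of the Poisson equation; for exponential demand both
  are explicit, the bias being quadratic.
\<close>

definition const_rate :: "real \<Rightarrow> real \<Rightarrow> real \<Rightarrow> real \<Rightarrow> real" where
  "const_rate h p \<mu> r = h * r\<^sup>2 / (2 * (\<mu> - r)) + p * (\<mu> - r)"

definition bias :: "real \<Rightarrow> real \<Rightarrow> real \<Rightarrow> real \<Rightarrow> real \<Rightarrow> real" where
  "bias h p \<mu> r y = h / (2 * (\<mu> - r)) * (y\<^sup>2 + 2 * r * y) - p * y"

lemma bias_0 [simp]: "bias h p \<mu> r 0 = 0"
  by (simp add: bias_def)

section \<open>Independence of past and future demands, and the cost of one period\<close>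

context exponential_demand
begin

text \<open>\<open>g\<close> is a functional of whole paths, but its measurability is given on a
  finite product. The congruence property lets the path be restricted to that product, and the index
  blocks \<open>{..<n}\<close> and \<open>{n..<m}\<close> are disjoint.\<close>

lemma
  assumes g: "g \<in> Pi\<^sub>M {..<n} (\<lambda>_. borel) \<rightarrow>\<^sub>M N"
    and g_cong: "\<And>d d'. (\<And>i. i < n \<Longrightarrow> d i = d' i) \<Longrightarrow> g d = g d'"
  shows past_measurable: "(\<lambda>\<omega>. g (\<lambda>s. D s \<omega>)) \<in> M \<rightarrow>\<^sub>M N"
    and indep_past_future: "\<lbrakk>f \<in> Pi\<^sub>M {n..<m} (\<lambda>_. borel) \<rightarrow>\<^sub>M K;
      \<And>d d'. (\<And>i. n \<le> i \<Longrightarrow> i < m \<Longrightarrow> d i = d' i) \<Longrightarrow> f d = f d'\<rbrakk> \<Longrightarrow>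
      indep_var N (\<lambda>\<omega>. g (\<lambda>s. D s \<omega>)) K (\<lambda>\<omega>. f (\<lambda>s. D s \<omega>))"
proof -
  have g_eq: "g \<circ> (\<lambda>\<omega>. \<lambda>s\<in>{..<n}. D s \<omega>) = (\<lambda>\<omega>. g (\<lambda>s. D s \<omega>))"
    by (auto simp: fun_eq_iff intro!: g_cong)
  have "(\<lambda>\<omega>. \<lambda>s\<in>{..<n}. D s \<omega>) \<in> M \<rightarrow>\<^sub>M Pi\<^sub>M {..<n} (\<lambda>_. borel)"
    by (intro measurable_restrict) simp
  from measurable_comp[OF this g] show "(\<lambda>\<omega>. g (\<lambda>s. D s \<omega>)) \<in> M \<rightarrow>\<^sub>M N"
    by (simp add: g_eq)
  assume f: "f \<in> Pi\<^sub>M {n..<m} (\<lambda>_. borel) \<rightarrow>\<^sub>M K"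
    and f_cong: "\<And>d d'. (\<And>i. n \<le> i \<Longrightarrow> i < m \<Longrightarrow> d i = d' i) \<Longrightarrow> f d = f d'"
  have f_eq: "f \<circ> (\<lambda>\<omega>. \<lambda>s\<in>{n..<m}. D s \<omega>) = (\<lambda>\<omega>. f (\<lambda>s. D s \<omega>))"
    by (auto simp: fun_eq_iff intro!: f_cong)
  have "indep_var (Pi\<^sub>M {..<n} (\<lambda>_. borel)) (\<lambda>\<omega>. \<lambda>s\<in>{..<n}. D s \<omega>)
      (Pi\<^sub>M {n..<m} (\<lambda>_. borel)) (\<lambda>\<omega>. \<lambda>s\<in>{n..<m}. D s \<omega>)"
    by (rule indep_var_restrict[OF indep]) auto
  from indep_var_compose[OF this g f]
  show "indep_var N (\<lambda>\<omega>. g (\<lambda>s. D s \<omega>)) K (\<lambda>\<omega>. f (\<lambda>s. D s \<omega>))"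
    by (simp add: f_eq g_eq)
qed

lemma indep_past_demand:
  assumes g: "g \<in> Pi\<^sub>M {..<n} (\<lambda>_. borel) \<rightarrow>\<^sub>M N"
    and g_cong: "\<And>d d'. (\<And>i. i < n \<Longrightarrow> d i = d' i) \<Longrightarrow> g d = g d'"
  shows "indep_var N (\<lambda>\<omega>. g (\<lambda>s. D s \<omega>)) borel (D n)"
  by (rule indep_past_future[OF g g_cong, where m = "Suc n" and f = "\<lambda>d. d n"])
     (auto intro!: measurable_component_singleton)

lemma
  assumes A: "A \<in> policies \<tau>"
  shows prior_inv_measurable [measurable]:
      "(\<lambda>\<omega>. prior_inv \<tau> A (\<lambda>s. D s \<omega>) t) \<in> borel_measurable M"
    and order_qty_measurable [measurable]:
      "(\<lambda>\<omega>. order_qty \<tau> A (\<lambda>s. D s \<omega>) t) \<in> borel_measurable M"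
    and inv_level_measurable [measurable]:
      "(\<lambda>\<omega>. inv_level \<tau> A (\<lambda>s. D s \<omega>) t) \<in> borel_measurable M"
    and indep_prior_inv: "indep_var borel (\<lambda>\<omega>. prior_inv \<tau> A (\<lambda>s. D s \<omega>) t) borel (D t)"
    and indep_inv_level: "indep_var borel (\<lambda>\<omega>. inv_level \<tau> A (\<lambda>s. D s \<omega>) t) borel (D t)"
proof -
  have m: "(\<lambda>d. prior_inv \<tau> A d t) \<in> Pi\<^sub>M {..<t} (\<lambda>_. borel) \<rightarrow>\<^sub>M borel"
    "(\<lambda>d. order_qty \<tau> A d t) \<in> Pi\<^sub>M {..<t} (\<lambda>_. borel) \<rightarrow>\<^sub>M borel"
    "(\<lambda>d. inv_level \<tau> A d t) \<in> Pi\<^sub>M {..<t} (\<lambda>_. borel) \<rightarrow>\<^sub>M borel"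
    using sample_path_measurable[OF A, of t t] by (auto dest: measurable_nonnegD(1))
  have c: "prior_inv \<tau> A d t = prior_inv \<tau> A d' t" "order_qty \<tau> A d t = order_qty \<tau> A d' t"
    "inv_level \<tau> A d t = inv_level \<tau> A d' t" if "\<And>i. i < t \<Longrightarrow> d i = d' i" for d d'
    using sample_path_cong[of t d d' t \<tau> A] that by auto
  show "(\<lambda>\<omega>. prior_inv \<tau> A (\<lambda>s. D s \<omega>) t) \<in> borel_measurable M"
    "(\<lambda>\<omega>. order_qty \<tau> A (\<lambda>s. D s \<omega>) t) \<in> borel_measurable M"
    "(\<lambda>\<omega>. inv_level \<tau> A (\<lambda>s. D s \<omega>) t) \<in> borel_measurable M"
    by (rule past_measurable[OF m(1) c(1)] past_measurable[OF m(2) c(2)]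
        past_measurable[OF m(3) c(3)]; assumption)+
  show "indep_var borel (\<lambda>\<omega>. prior_inv \<tau> A (\<lambda>s. D s \<omega>) t) borel (D t)"
    "indep_var borel (\<lambda>\<omega>. inv_level \<tau> A (\<lambda>s. D s \<omega>) t) borel (D t)"
    by (rule indep_past_demand[OF m(1) c(1)] indep_past_demand[OF m(3) c(3)]; assumption)+
qed

text \<open>
  The bias is the sum of a linear part, whose expectation after a period is determined by the
  balance \<open>J = X - D + L\<close>, and a quadratic part, for which \<open>J\<^sup>2 = (X - D)\<^sup>2 - L\<^sup>2\<close> and
  \<open>E[L\<^sup>2] = 2 \<mu> E[L]\<close>, so that the expected lost sales cancel.
\<close>

lemma one_period_cost:
  assumes ind: "indep_var borel X borel (D t)" and bnd: "AE \<omega> in M. 0 \<le> X \<omega> \<and> X \<omega> \<le> B"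
    and r: "r < \<mu>"
  defines "J \<equiv> \<lambda>\<omega>. max 0 (X \<omega> - D t \<omega>)" and "L \<equiv> \<lambda>\<omega>. max 0 (D t \<omega> - X \<omega>)"
  shows "integrable M J" "integrable M (\<lambda>\<omega>. (J \<omega>)\<^sup>2)" "integrable M L"
    and "expectation (\<lambda>\<omega>. h * J \<omega> + p * L \<omega>) =
      h / (2 * (\<mu> - r)) * expectation (\<lambda>\<omega>. (X \<omega>)\<^sup>2) + p * (\<mu> - expectation X)
        - expectation (\<lambda>\<omega>. bias h p \<mu> r (J \<omega>))"
proof -
  have X [measurable]: "X \<in> borel_measurable M"
    using indep_var_rv1[OF ind] .
  have iX: "integrable M X"
  proof (rule integrable_const_bound)
    show "AE \<omega> in M. norm (X \<omega>) \<le> B"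
      using bnd by eventually_elim auto
  qed simp
  have iX2: "integrable M (\<lambda>\<omega>. (X \<omega>)\<^sup>2)"
  proof (rule integrable_const_bound)
    show "AE \<omega> in M. norm ((X \<omega>)\<^sup>2) \<le> B\<^sup>2"
      using bnd by eventually_elim (auto intro: power_mono)
  qed simp
  have iXD: "integrable M (\<lambda>\<omega>. X \<omega> * D t \<omega>)"
    by (rule indep_var_integrable[OF ind iX demand_integrable])
  have EXD: "expectation (\<lambda>\<omega>. X \<omega> * D t \<omega>) = expectation X * \<mu>"
    by (simp add: indep_var_lebesgue_integral[OF ind iX demand_integrable] expectation_demand)
  have nonneg: "AE \<omega> in M. 0 \<le> X \<omega>"
    using bnd by eventually_elim simp
  note L = integrable_excess[OF ind nonneg] integrable_excess_square[OF ind nonneg]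
    expectation_excess_square[OF ind nonneg]
  note ints = iX iX2 iXD L(1,2) demand_integrable demand_integrable_power[of t 2]
  show iL: "integrable M L" using L(1) by (simp add: L_def)
  have J: "J = (\<lambda>\<omega>. X \<omega> - D t \<omega> + L \<omega>)"
    by (auto simp: J_def L_def)
  have J2: "(\<lambda>\<omega>. (J \<omega>)\<^sup>2) = (\<lambda>\<omega>. (X \<omega>)\<^sup>2 - 2 * (X \<omega> * D t \<omega>) + (D t \<omega>)\<^sup>2 - (L \<omega>)\<^sup>2)"
    by (auto simp: J_def L_def max_def power2_eq_square algebra_simps)
  show iJ: "integrable M J"
    unfolding J using ints iL by (intro Bochner_Integration.integrable_add Bochner_Integration.integrable_diff)
  show iJ2: "integrable M (\<lambda>\<omega>. (J \<omega>)\<^sup>2)"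
    unfolding J2 using ints by (simp add: L_def)
  have EJ: "expectation J = expectation X - \<mu> + expectation L"
    unfolding J using iL iX demand_integrable by (simp add: expectation_demand)
  have EJ2: "expectation (\<lambda>\<omega>. (J \<omega>)\<^sup>2) =
      expectation (\<lambda>\<omega>. (X \<omega>)\<^sup>2) - 2 * \<mu> * expectation X + 2 * \<mu>\<^sup>2 - 2 * \<mu> * expectation L"
    unfolding J2 using ints L(3) by (simp add: L_def EXD expectation_demand_square)
  define a where "a = h / (2 * (\<mu> - r))"
  have h: "h = a * (2 * (\<mu> - r))"
    using r by (simp add: a_def nonzero_eq_divide_eq[symmetric])
  have "expectation (\<lambda>\<omega>. bias h p \<mu> r (J \<omega>)) =
      a * (expectation (\<lambda>\<omega>. (J \<omega>)\<^sup>2) + 2 * r * expectation J) - p * expectation J"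
    unfolding bias_def a_def[symmetric] using iJ iJ2 by simp
  moreover have "expectation (\<lambda>\<omega>. h * J \<omega> + p * L \<omega>) = h * expectation J + p * expectation L"
    using iJ iL by simp
  ultimately show "expectation (\<lambda>\<omega>. h * J \<omega> + p * L \<omega>) =
      h / (2 * (\<mu> - r)) * expectation (\<lambda>\<omega>. (X \<omega>)\<^sup>2) + p * (\<mu> - expectation X)
        - expectation (\<lambda>\<omega>. bias h p \<mu> r (J \<omega>))"
    unfolding a_def[symmetric] EJ EJ2 by (simp add: h algebra_simps power2_eq_square)
qed

end

lemma period_cost_eq:
  "period_cost h p \<tau> A d s = h * max 0 (inv_level \<tau> A d s - d s) + p * max 0 (d s - inv_level \<tau> A d s)"
  by (simp add: period_cost_def end_inv_def lost_sales_def)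

lemma period_cost_nonneg: "h \<ge> 0 \<Longrightarrow> p \<ge> 0 \<Longrightarrow> period_cost h p \<tau> A d s \<ge> 0"
  by (simp add: period_cost_eq)

lemma order_qty_const: "order_qty \<tau> (const_policy r) d s = (if s < \<tau> then 0 else r)"
  by (simp add: order_qty.simps const_policy_def)

text \<open>Completing the square in the parabola: its leading coefficient \<open>a\<close> is
  positive because \<open>r < \<mu>\<close>, and its vertex lies at \<open>- b\<close>.\<close>

lemma bias_lower:
  assumes "h > 0" "r < \<mu>"
  obtains K where "\<And>y. bias h p \<mu> r y \<ge> - K"
proof
  define a where "a = h / (2 * (\<mu> - r))"
  have a: "a > 0" using assms by (simp add: a_def)
  define b where "b = r - p / (2 * a)"
  have b: "2 * a * b = 2 * a * r - p" using a by (simp add: b_def field_simps)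
  show "bias h p \<mu> r y \<ge> - (a * b\<^sup>2)" for y
  proof -
    have "bias h p \<mu> r y = a * y\<^sup>2 + (2 * a * r - p) * y"
      unfolding bias_def a_def[symmetric] by (simp add: algebra_simps)
    also have "\<dots> = a * (y + b)\<^sup>2 - a * b\<^sup>2"
      unfolding b[symmetric] by (simp add: algebra_simps power2_eq_square)
    finally show ?thesis using a by simp
  qed
qed

text \<open>An exponential dominates a quadratic: Taylor bounds give
  \<open>y\<^sup>2 \<le> (2 / \<theta>\<^sup>2) * exp (\<theta> * y)\<close> and
  \<open>y \<le> (1 / \<theta>) * exp (\<theta> * y)\<close>, whence the constant. Exponential
  moments thus bound the expected bias.\<close>

lemma bias_exp_bound:
  assumes "\<theta> > 0"
  obtains C where "C \<ge> 0" "\<And>y. y \<ge> 0 \<Longrightarrow> \<bar>bias h p \<mu> r y\<bar> \<le> C * exp (\<theta> * y)"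
proof
  define a where "a = \<bar>h / (2 * (\<mu> - r))\<bar>"
  let ?C = "a * (2 / \<theta>\<^sup>2) + (2 * a * \<bar>r\<bar> + \<bar>p\<bar>) / \<theta>"
  show "?C \<ge> 0" using assms by (auto simp: a_def intro!: add_nonneg_nonneg)
  show "\<bar>bias h p \<mu> r y\<bar> \<le> ?C * exp (\<theta> * y)" if y: "y \<ge> 0" for y
  proof -
    have "\<theta> * y \<ge> 0" using y assms by simp
    then have "(\<theta> * y)\<^sup>2 / 2 \<le> exp (\<theta> * y)" "\<theta> * y \<le> exp (\<theta> * y)"
      using exp_lower_Taylor_quadratic[of "\<theta> * y"] exp_ge_add_one_self[of "\<theta> * y"] by linarith+
    then have e: "y\<^sup>2 \<le> (2 / \<theta>\<^sup>2) * exp (\<theta> * y)" "y \<le> (1 / \<theta>) * exp (\<theta> * y)"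
      using assms by (auto simp: field_simps power_mult_distrib)
    have "bias h p \<mu> r y = h / (2 * (\<mu> - r)) * y\<^sup>2 + (2 * (h / (2 * (\<mu> - r))) * r - p) * y"
      unfolding bias_def by (simp add: algebra_simps add_divide_distrib)
    also have "\<bar>\<dots>\<bar> \<le> \<bar>h / (2 * (\<mu> - r)) * y\<^sup>2\<bar> + \<bar>(2 * (h / (2 * (\<mu> - r))) * r - p) * y\<bar>"
      by (rule abs_triangle_ineq)
    also have "\<dots> = a * y\<^sup>2 + \<bar>2 * (h / (2 * (\<mu> - r))) * r - p\<bar> * y"
      using y by (simp only: abs_mult a_def) simp
    also have "\<bar>2 * (h / (2 * (\<mu> - r))) * r - p\<bar> \<le> 2 * a * \<bar>r\<bar> + \<bar>p\<bar>"
      using abs_triangle_ineq4[of "2 * (h / (2 * (\<mu> - r))) * r" p] by (simp add: abs_mult a_def)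
    then have "a * y\<^sup>2 + \<bar>2 * (h / (2 * (\<mu> - r))) * r - p\<bar> * y \<le> a * y\<^sup>2 + (2 * a * \<bar>r\<bar> + \<bar>p\<bar>) * y"
      using y by (intro add_left_mono mult_right_mono)
    also have "\<dots> \<le> a * ((2 / \<theta>\<^sup>2) * exp (\<theta> * y)) + (2 * a * \<bar>r\<bar> + \<bar>p\<bar>) * ((1 / \<theta>) * exp (\<theta> * y))"
      by (intro add_mono mult_left_mono e) (auto simp: a_def)
    also have "\<dots> = ?C * exp (\<theta> * y)"
      by (simp add: algebra_simps add_divide_distrib)
    finally show ?thesis .
  qed
qed

context exponential_demand
begin

lemma AE_system_bounds:
  assumes "A \<in> policies \<tau>" "B \<ge> 0" "\<forall>t. \<forall>x\<in>space (state_space \<tau>). A t x \<le> B"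
  shows "AE \<omega> in M. prior_inv \<tau> A (\<lambda>s. D s \<omega>) t \<le> real t * B"
    and "AE \<omega> in M. 0 \<le> inv_level \<tau> A (\<lambda>s. D s \<omega>) t \<and> inv_level \<tau> A (\<lambda>s. D s \<omega>) t \<le> (real t + 1) * B"
proof -
  show p: "AE \<omega> in M. prior_inv \<tau> A (\<lambda>s. D s \<omega>) t \<le> real t * B"
    using AE_demand_nonneg by eventually_elim (rule prior_inv_le[OF assms], auto)
  show "AE \<omega> in M. 0 \<le> inv_level \<tau> A (\<lambda>s. D s \<omega>) t \<and> inv_level \<tau> A (\<lambda>s. D s \<omega>) t \<le> (real t + 1) * B"
    using p
  proof eventually_elim
    case (elim \<omega>)
    then show ?case
      using inv_level_nonneg[OF assms(1), of "\<lambda>s. D s \<omega>" t] order_qty_le[OF assms, of "\<lambda>s. D s \<omega>" t]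
      by (simp add: inv_level.simps[of \<tau> A _ t] algebra_simps)
  qed
qed

lemma AE_prior_inv_initial: "AE \<omega> in M. prior_inv \<tau> A (\<lambda>s. D s \<omega>) \<tau> = 0"
  using AE_demand_nonneg by eventually_elim (simp add: prior_inv_initial)

text \<open>The Poisson equation with a defect. With \<open>a = h / (2 * (\<mu> - r))\<close>,
  ordering \<open>q\<close> instead of \<open>r\<close> changes
  \<open>a * (y + r)\<^sup>2 - p * (y + r)\<close> into
  \<open>a * (y + q)\<^sup>2 - p * (y + q)\<close>; the last expectation is this difference in
  factored form and vanishes for \<open>q = r\<close>.\<close>

lemma expectation_period_cost:
  assumes A: "A \<in> policies \<tau>" and B: "B \<ge> 0" "\<forall>t. \<forall>x\<in>space (state_space \<tau>). A t x \<le> B"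
    and r: "r < \<mu>"
  defines "y \<equiv> \<lambda>s \<omega>. prior_inv \<tau> A (\<lambda>s. D s \<omega>) s" and "q \<equiv> \<lambda>s \<omega>. order_qty \<tau> A (\<lambda>s. D s \<omega>) s"
  shows "integrable M (\<lambda>\<omega>. period_cost h p \<tau> A (\<lambda>s. D s \<omega>) s)"
    and "expectation (\<lambda>\<omega>. period_cost h p \<tau> A (\<lambda>s. D s \<omega>) s) =
      const_rate h p \<mu> r + expectation (\<lambda>\<omega>. bias h p \<mu> r (y s \<omega>))
        - expectation (\<lambda>\<omega>. bias h p \<mu> r (y (Suc s) \<omega>))
        + expectation (\<lambda>\<omega>. (q s \<omega> - r) * (h / (2 * (\<mu> - r)) * (2 * y s \<omega> + q s \<omega> + r) - p))"
proof -
  define X where "X = (\<lambda>\<omega>. inv_level \<tau> A (\<lambda>s. D s \<omega>) s)"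
  have X: "X = (\<lambda>\<omega>. y s \<omega> + q s \<omega>)"
    by (simp add: X_def y_def q_def inv_level.simps[of \<tau> A _ s])
  have X_app: "inv_level \<tau> A (\<lambda>s. D s \<omega>) s = X \<omega>" for \<omega>
    by (simp add: X_def)
  note one = one_period_cost[OF indep_inv_level[OF A] AE_system_bounds(2)[OF A B] r,
      where t = s, unfolded X_app]
  have [measurable]: "y s \<in> borel_measurable M" "q s \<in> borel_measurable M"
    using A by (auto simp: y_def q_def)
  have iy: "integrable M (y s)"
  proof (rule integrable_const_bound)
    show "AE \<omega> in M. norm (y s \<omega>) \<le> real s * B"
      using AE_system_bounds(1)[OF A B, of s] by eventually_elim (simp add: y_def prior_inv_nonneg)
  qed simp
  have iy2: "integrable M (\<lambda>\<omega>. (y s \<omega>)\<^sup>2)"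
  proof (rule integrable_const_bound)
    show "AE \<omega> in M. norm ((y s \<omega>)\<^sup>2) \<le> (real s * B)\<^sup>2"
      using AE_system_bounds(1)[OF A B, of s]
      by eventually_elim (auto simp: y_def prior_inv_nonneg intro: power_mono)
  qed simp
  have qb: "\<bar>q s \<omega>\<bar> \<le> B" for \<omega>
    using order_qty_le[OF A B] order_qty_nonneg[OF A] by (simp add: q_def)
  have iq: "integrable M (q s)"
    by (rule integrable_const_bound[of _ B]) (auto simp: qb)
  have iq2: "integrable M (\<lambda>\<omega>. (q s \<omega>)\<^sup>2)"
    by (rule integrable_const_bound[of _ "B\<^sup>2"]) (auto simp: abs_le_square_iff[symmetric] qb B)
  have iyq: "integrable M (\<lambda>\<omega>. y s \<omega> * q s \<omega>)"
    by (rule Bochner_Integration.integrable_bound[OF integrable_mult_left[OF iy, of B]])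
       (auto simp: abs_mult B intro!: mult_left_mono qb)
  have cost: "(\<lambda>\<omega>. period_cost h p \<tau> A (\<lambda>s. D s \<omega>) s) =
      (\<lambda>\<omega>. h * max 0 (X \<omega> - D s \<omega>) + p * max 0 (D s \<omega> - X \<omega>))"
    by (simp add: period_cost_eq X_def)
  show "integrable M (\<lambda>\<omega>. period_cost h p \<tau> A (\<lambda>s. D s \<omega>) s)"
    unfolding cost using one(1,3) by simp
  have ySuc: "max 0 (X \<omega> - D s \<omega>) = y (Suc s) \<omega>" for \<omega>
    by (simp add: X y_def q_def prior_inv_Suc)
  define a where "a = h / (2 * (\<mu> - r))"
  have h: "h = a * (2 * (\<mu> - r))"
    using r by (simp add: a_def nonzero_eq_divide_eq[symmetric])
  have Eb: "expectation (\<lambda>\<omega>. bias h p \<mu> r (y s \<omega>)) =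
      a * (expectation (\<lambda>\<omega>. (y s \<omega>)\<^sup>2) + 2 * r * expectation (y s)) - p * expectation (y s)"
    unfolding bias_def a_def[symmetric] using iy iy2 by simp
  have "expectation (\<lambda>\<omega>. (q s \<omega> - r) * (a * (2 * y s \<omega> + q s \<omega> + r) - p)) =
    expectation (\<lambda>\<omega>. 2 * a * (y s \<omega> * q s \<omega>) + a * (q s \<omega>)\<^sup>2 - 2 * a * r * y s \<omega> - p * q s \<omega> + (p * r - a * r\<^sup>2))"
    by (rule arg_cong[where f = "integral\<^sup>L M"]) (auto simp: algebra_simps power2_eq_square)
  also have "\<dots> = 2 * a * expectation (\<lambda>\<omega>. y s \<omega> * q s \<omega>) + a * expectation (\<lambda>\<omega>. (q s \<omega>)\<^sup>2)
      - 2 * a * r * expectation (y s) - p * expectation (q s) + (p * r - a * r\<^sup>2)"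
    using iy iq iq2 iyq by (simp add: prob_space)
  finally have Eq: "expectation (\<lambda>\<omega>. (q s \<omega> - r) * (a * (2 * y s \<omega> + q s \<omega> + r) - p)) = \<dots>" .
  have "expectation (\<lambda>\<omega>. (X \<omega>)\<^sup>2) = expectation (\<lambda>\<omega>. (y s \<omega>)\<^sup>2 + 2 * (y s \<omega> * q s \<omega>) + (q s \<omega>)\<^sup>2)"
    by (rule arg_cong[where f = "integral\<^sup>L M"]) (auto simp: X algebra_simps power2_eq_square)
  also have "\<dots> = expectation (\<lambda>\<omega>. (y s \<omega>)\<^sup>2) + 2 * expectation (\<lambda>\<omega>. y s \<omega> * q s \<omega>)
      + expectation (\<lambda>\<omega>. (q s \<omega>)\<^sup>2)"
    using iy2 iyq iq2 by simp
  finally have EX2: "expectation (\<lambda>\<omega>. (X \<omega>)\<^sup>2) = \<dots>" .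
  have EX: "expectation X = expectation (y s) + expectation (q s)"
    unfolding X using iy iq by simp
  have g: "const_rate h p \<mu> r = a * r\<^sup>2 + p * (\<mu> - r)"
    by (simp add: const_rate_def a_def)
  show "expectation (\<lambda>\<omega>. period_cost h p \<tau> A (\<lambda>s. D s \<omega>) s) =
      const_rate h p \<mu> r + expectation (\<lambda>\<omega>. bias h p \<mu> r (y s \<omega>))
        - expectation (\<lambda>\<omega>. bias h p \<mu> r (y (Suc s) \<omega>))
        + expectation (\<lambda>\<omega>. (q s \<omega> - r) * (h / (2 * (\<mu> - r)) * (2 * y s \<omega> + q s \<omega> + r) - p))"
    using one(4)[where h = h and p = p]
    unfolding cost ySuc a_def[symmetric] Eq Eb EX EX2 g by (simp add: algebra_simps)
qed

section \<open>Finite-horizon costs and exponential moments\<close>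

text \<open>The bias differences telescope and the initial one is 0. The assumption
  \<open>step\<close> says that, in expectation, the orders are no worse than \<open>r\<close> as
  measured by the bias of \<open>C^r\<close>.\<close>

lemma expectation_sum_cost_le:
  assumes A: "A \<in> policies \<tau>" and B: "B \<ge> 0" "\<forall>t. \<forall>x\<in>space (state_space \<tau>). A t x \<le> B"
    and r: "r < \<mu>"
    and step: "\<And>s. s \<ge> \<tau> \<Longrightarrow> expectation (\<lambda>\<omega>. (order_qty \<tau> A (\<lambda>s. D s \<omega>) s - r) *
      (h / (2 * (\<mu> - r)) * (2 * prior_inv \<tau> A (\<lambda>s. D s \<omega>) s + order_qty \<tau> A (\<lambda>s. D s \<omega>) s + r) - p)) \<le> 0"
  shows "(\<Sum>s<n. expectation (\<lambda>\<omega>. period_cost h p \<tau> A (\<lambda>s. D s \<omega>) (\<tau> + s))) \<le>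
    real n * const_rate h p \<mu> r - expectation (\<lambda>\<omega>. bias h p \<mu> r (prior_inv \<tau> A (\<lambda>s. D s \<omega>) (\<tau> + n)))"
proof (induction n)
  case 0
  have "expectation (\<lambda>\<omega>. bias h p \<mu> r (prior_inv \<tau> A (\<lambda>s. D s \<omega>) \<tau>)) = 0"
    using AE_prior_inv_initial[of \<tau> A] by (intro integral_eq_zero_AE) (auto elim!: eventually_mono)
  then show ?case by simp
next
  case (Suc n)
  then show ?case
    using step[of "\<tau> + n"] expectation_period_cost(2)[OF A B r, of h p "\<tau> + n"]
    by (simp add: algebra_simps)
qed

lemma expectation_sum_const_cost:
  assumes r: "0 \<le> r" "r < \<mu>"
  shows "(\<Sum>s<n. expectation (\<lambda>\<omega>. period_cost h p \<tau> (const_policy r) (\<lambda>s. D s \<omega>) (\<tau> + s))) =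
    real n * const_rate h p \<mu> r
      - expectation (\<lambda>\<omega>. bias h p \<mu> r (prior_inv \<tau> (const_policy r) (\<lambda>s. D s \<omega>) (\<tau> + n)))"
proof (induction n)
  case 0
  have "expectation (\<lambda>\<omega>. bias h p \<mu> r (prior_inv \<tau> (const_policy r) (\<lambda>s. D s \<omega>) \<tau>)) = 0"
    using AE_prior_inv_initial[of \<tau> "const_policy r"] by (intro integral_eq_zero_AE) (auto elim!: eventually_mono)
  then show ?case by simp
next
  case (Suc n)
  have le: "\<forall>t. \<forall>x\<in>space (state_space \<tau>). const_policy r t x \<le> r"
    by (simp add: const_policy_def)
  from Suc show ?case
    using expectation_period_cost(2)[OF const_policy_in_policies[OF r(1)] r(1) le r(2),
        of h p "\<tau> + n"]
    by (simp add: algebra_simps order_qty_const)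
qed

text \<open>A geometric drift condition. For small \<open>\<theta> > 0\<close> the mean of
  \<open>exp (\<theta> * (r - D))\<close> is some \<open>\<rho> < 1\<close>, and one period turns a
  bound \<open>x\<close> on the moment into \<open>1 + \<rho> * x\<close>. The fixed point
  \<open>1 / (1 - \<rho>)\<close> is a bound uniform in \<open>\<tau>\<close> and
  \<open>s\<close>.\<close>

lemma const_policy_exp_moment:
  assumes r: "0 \<le> r" "r < \<mu>"
  obtains \<theta> K where "\<theta> > 0"
    "\<And>\<tau> s. integrable M (\<lambda>\<omega>. exp (\<theta> * prior_inv \<tau> (const_policy r) (\<lambda>s. D s \<omega>) s))"
    "\<And>\<tau> s. expectation (\<lambda>\<omega>. exp (\<theta> * prior_inv \<tau> (const_policy r) (\<lambda>s. D s \<omega>) s)) \<le> K"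
proof -
  \<comment> \<open>The slope at 0 is positive because \<open>r < \<mu>\<close>, which yields
    \<open>exp (\<theta> * r) < 1 + \<theta> * \<mu>\<close> for small
    \<open>\<theta>\<close>.\<close>
  have "((\<lambda>x. 1 + x * \<mu> - exp (x * r)) has_real_derivative (\<mu> - r)) (at 0)"
    by (auto intro!: derivative_eq_intros)
  from DERIV_pos_inc_right[OF this] r obtain d
    where d: "d > 0" "\<And>x. 0 < x \<Longrightarrow> x < d \<Longrightarrow> exp (x * r) < 1 + x * \<mu>"
    by auto
  define \<theta> where "\<theta> = d / 2"
  have \<theta>: "\<theta> > 0" "exp (\<theta> * r) < 1 + \<theta> * \<mu>"
    using d(1) d(2)[of \<theta>] by (auto simp: \<theta>_def)
  define \<rho> where "\<rho> = exp (\<theta> * r) / (1 + \<theta> * \<mu>)"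
  have "1 + \<theta> * \<mu> > 0" using \<theta> mean_pos by (simp add: add_pos_pos)
  then have \<rho>: "0 \<le> \<rho>" "\<rho> < 1" using \<theta> by (auto simp: \<rho>_def)
  have pol: "const_policy r \<in> policies \<tau>" for \<tau>
    by (rule const_policy_in_policies[OF r(1)])
  have le: "\<forall>t. \<forall>x\<in>space (state_space \<tau>). const_policy r t x \<le> r" for \<tau>
    by (simp add: const_policy_def)
  define e where "e = (\<lambda>\<tau> s \<omega>. exp (\<theta> * prior_inv \<tau> (const_policy r) (\<lambda>s. D s \<omega>) s))"
  have me [measurable]: "e \<tau> s \<in> borel_measurable M" for \<tau> s
    unfolding e_def using pol by simp
  have int: "integrable M (e \<tau> s)" for \<tau> s
  proof (rule integrable_const_bound)
    show "AE \<omega> in M. norm (e \<tau> s \<omega>) \<le> exp (\<theta> * (real s * r))"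
      using AE_system_bounds(1)[OF pol r(1) le, of \<tau> s] by eventually_elim (use \<theta> in \<open>simp add: e_def\<close>)
  qed simp
  have "expectation (e \<tau> s) \<le> 1 / (1 - \<rho>)" for \<tau> s
  proof (induction s)
    case 0
    then show ?case using \<rho> by (simp add: e_def prior_inv_0 prob_space field_simps)
  next
    case (Suc s)
    let ?g = "\<lambda>\<omega>. exp (- \<theta> * D s \<omega>)"
    have "indep_var borel ((\<lambda>x. exp (\<theta> * x)) \<circ> (\<lambda>\<omega>. prior_inv \<tau> (const_policy r) (\<lambda>s. D s \<omega>) s))
        borel ((\<lambda>x. exp (- \<theta> * x)) \<circ> D s)"
      by (rule indep_var_compose[OF indep_prior_inv[OF pol]]) auto
    then have ind: "indep_var borel (e \<tau> s) borel ?g"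
      by (simp add: e_def comp_def)
    have ig: "integrable M ?g"
      using expectation_exp_demand(1)[of \<theta> s] \<theta> by simp
    have "expectation (e \<tau> (Suc s)) \<le> expectation (\<lambda>\<omega>. 1 + exp (\<theta> * r) * (e \<tau> s \<omega> * ?g \<omega>))"
    proof (rule integral_mono)
      show "integrable M (\<lambda>\<omega>. 1 + exp (\<theta> * r) * (e \<tau> s \<omega> * ?g \<omega>))"
        using indep_var_integrable[OF ind int ig] by simp
      show "e \<tau> (Suc s) \<omega> \<le> 1 + exp (\<theta> * r) * (e \<tau> s \<omega> * ?g \<omega>)" for \<omega>
      proof -
        let ?z = "prior_inv \<tau> (const_policy r) (\<lambda>s. D s \<omega>) s + r - D s \<omega>"
        \<comment> \<open>Only an inequality, since before period \<open>\<tau>\<close> the arriving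
          order is 0 and not \<open>r\<close>.\<close>
        have "prior_inv \<tau> (const_policy r) (\<lambda>s. D s \<omega>) (Suc s) \<le> max 0 ?z"
          using r by (auto simp: prior_inv_Suc order_qty_const)
        then have "e \<tau> (Suc s) \<omega> \<le> exp (\<theta> * max 0 ?z)"
          using \<theta> by (simp add: e_def)
        also have "\<dots> \<le> 1 + exp (\<theta> * ?z)"
          by (cases "?z \<ge> 0") (auto simp: max_def)
        also have "exp (\<theta> * ?z) = exp (\<theta> * r) * (e \<tau> s \<omega> * ?g \<omega>)"
          by (simp add: e_def exp_add[symmetric] algebra_simps)
        finally show ?thesis .
      qed
    qed (rule int)
    also have "\<dots> = 1 + exp (\<theta> * r) * (expectation (e \<tau> s) * expectation ?g)"
      using indep_var_integrable[OF ind int ig] indep_var_lebesgue_integral[OF ind int ig]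
      by (simp add: prob_space)
    also have "\<dots> = 1 + \<rho> * expectation (e \<tau> s)"
      using expectation_exp_demand(2)[of \<theta> s] \<theta> by (simp add: \<rho>_def)
    also have "\<dots> \<le> 1 + \<rho> * (1 / (1 - \<rho>))"
      using Suc \<rho> by (intro add_left_mono mult_left_mono)
    also have "\<dots> = 1 / (1 - \<rho>)"
      using \<rho> by (simp add: field_simps)
    finally show ?case .
  qed
  then show thesis
    using \<theta>(1) int by (intro that[of \<theta> "1 / (1 - \<rho>)"]) (auto simp: e_def)
qed

lemma const_policy_bias_bounded:
  assumes r: "0 \<le> r" "r < \<mu>"
  obtains K where
    "\<And>\<tau> s. \<bar>expectation (\<lambda>\<omega>. bias h p \<mu> r (prior_inv \<tau> (const_policy r) (\<lambda>s. D s \<omega>) s))\<bar> \<le> K"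
proof -
  from const_policy_exp_moment[OF r] obtain \<theta> K where \<theta>: "\<theta> > 0"
    and int: "\<And>\<tau> s. integrable M (\<lambda>\<omega>. exp (\<theta> * prior_inv \<tau> (const_policy r) (\<lambda>s. D s \<omega>) s))"
    and K: "\<And>\<tau> s. expectation (\<lambda>\<omega>. exp (\<theta> * prior_inv \<tau> (const_policy r) (\<lambda>s. D s \<omega>) s)) \<le> K"
    by metis
  from bias_exp_bound[OF \<theta>] obtain C
    where C: "C \<ge> 0" "\<And>y. y \<ge> 0 \<Longrightarrow> \<bar>bias h p \<mu> r y\<bar> \<le> C * exp (\<theta> * y)"
    by metis
  have "\<bar>expectation (\<lambda>\<omega>. bias h p \<mu> r (prior_inv \<tau> (const_policy r) (\<lambda>s. D s \<omega>) s))\<bar> \<le> C * K" for \<tau> s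
  proof -
    let ?y = "\<lambda>\<omega>. prior_inv \<tau> (const_policy r) (\<lambda>s. D s \<omega>) s"
    have "\<bar>expectation (\<lambda>\<omega>. bias h p \<mu> r (?y \<omega>))\<bar> \<le> expectation (\<lambda>\<omega>. \<bar>bias h p \<mu> r (?y \<omega>)\<bar>)"
      by (rule integral_abs_bound)
    also have "\<dots> \<le> expectation (\<lambda>\<omega>. C * exp (\<theta> * ?y \<omega>))"
      using int C by (intro integral_mono') (auto simp: prior_inv_nonneg)
    also have "\<dots> \<le> C * K"
      using K[of \<tau> s] C by (auto intro: mult_left_mono)
    finally show ?thesis .
  qed
  then show thesis by (rule that)
qed


section \<open>Cost-rates from finite-horizon averages\<close>

lemma period_cost_measurable [measurable]:
  assumes [measurable]: "A \<in> policies \<tau>"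
  shows "(\<lambda>\<omega>. period_cost h p \<tau> A (\<lambda>s. D s \<omega>) s) \<in> borel_measurable M"
  unfolding period_cost_eq using assms by simp

text \<open>The substitution \<open>T = n + \<tau>\<close> discards the finitely many horizons below
  \<open>\<tau>\<close>, whose sums are empty and whose factor is not positive. Horizon
  \<open>n + \<tau>\<close> comprises \<open>Suc n\<close> periods.\<close>

lemma cost_rate_eq_limsup:
  "cost_rate M D h p \<tau> A =
    limsup (\<lambda>n. enn2ereal (\<integral>\<^sup>+\<omega>. ennreal ((\<Sum>s<Suc n. period_cost h p \<tau> A (\<lambda>s. D s \<omega>) (\<tau> + s)) / real (Suc n)) \<partial>M))"
proof -
  have "(\<Sum>t=\<tau>..n + \<tau>. f t) = (\<Sum>s<Suc n. f (\<tau> + s))" for f :: "nat \<Rightarrow> real" and n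
    by (rule sum.reindex_bij_witness[of _ "\<lambda>s. \<tau> + s" "\<lambda>t. t - \<tau>"]) auto
  then have *: "1 / (real (n + \<tau>) - real \<tau> + 1) * (\<Sum>t=\<tau>..n + \<tau>. f t) =
      (\<Sum>s<Suc n. f (\<tau> + s)) / real (Suc n)" for f :: "nat \<Rightarrow> real" and n
    by (simp only:) simp
  show ?thesis
    unfolding cost_rate_def
    by (subst limsup_shift_k[of _ \<tau>, symmetric]) (simp only: *)
qed

lemma expected_average_cost:
  assumes hp: "h \<ge> 0" "p \<ge> 0"
    and int: "\<And>s. s < Suc n \<Longrightarrow> integrable M (\<lambda>\<omega>. period_cost h p \<tau> A (\<lambda>s. D s \<omega>) (\<tau> + s))"
  shows "enn2ereal (\<integral>\<^sup>+\<omega>. ennreal ((\<Sum>s<Suc n. period_cost h p \<tau> A (\<lambda>s. D s \<omega>) (\<tau> + s)) / real (Suc n)) \<partial>M)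
    = ereal ((\<Sum>s<Suc n. expectation (\<lambda>\<omega>. period_cost h p \<tau> A (\<lambda>s. D s \<omega>) (\<tau> + s))) / real (Suc n))"
proof -
  let ?f = "\<lambda>\<omega>. (\<Sum>s<Suc n. period_cost h p \<tau> A (\<lambda>s. D s \<omega>) (\<tau> + s)) / real (Suc n)"
  have i: "integrable M (\<lambda>\<omega>. \<Sum>s<Suc n. period_cost h p \<tau> A (\<lambda>s. D s \<omega>) (\<tau> + s))"
    using int by (intro Bochner_Integration.integrable_sum) auto
  then have if': "integrable M ?f" by (rule integrable_divide_zero)
  have nn: "?f \<omega> \<ge> 0" for \<omega>
    using hp by (intro divide_nonneg_nonneg sum_nonneg period_cost_nonneg) auto
  have "(\<integral>\<^sup>+\<omega>. ennreal (?f \<omega>) \<partial>M) = ennreal (expectation ?f)"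
    using if' nn by (intro nn_integral_eq_integral) auto
  also have "enn2ereal \<dots> = ereal (expectation ?f)"
    using nn by (intro enn2ereal_ennreal integral_nonneg_AE) auto
  also have "expectation ?f =
      (\<Sum>s<Suc n. expectation (\<lambda>\<omega>. period_cost h p \<tau> A (\<lambda>s. D s \<omega>) (\<tau> + s))) / real (Suc n)"
    using int by (subst integral_divide_zero, subst Bochner_Integration.integral_sum) auto
  finally show ?thesis .
qed

lemma const_plus_over_Suc_tendsto: "(\<lambda>n. ereal (g + K / real (Suc n))) \<longlonglongrightarrow> ereal g"
  using tendsto_add[OF tendsto_const LIMSEQ_Suc[OF lim_const_over_n], of g K]
  by (intro tendsto_ereal) simp

lemma cost_rate_le:
  assumes hp: "h \<ge> 0" "p \<ge> 0"
    and int: "\<And>s. integrable M (\<lambda>\<omega>. period_cost h p \<tau> A (\<lambda>s. D s \<omega>) s)"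
    and le: "\<And>n. (\<Sum>s<n. expectation (\<lambda>\<omega>. period_cost h p \<tau> A (\<lambda>s. D s \<omega>) (\<tau> + s))) \<le> real n * g + K"
  shows "cost_rate M D h p \<tau> A \<le> ereal g"
proof -
  have "cost_rate M D h p \<tau> A \<le> limsup (\<lambda>n. ereal (g + K / real (Suc n)))"
    unfolding cost_rate_eq_limsup expected_average_cost[OF hp int]
  proof (intro Limsup_mono always_eventually allI)
    fix n
    have "(\<Sum>s<Suc n. expectation (\<lambda>\<omega>. period_cost h p \<tau> A (\<lambda>s. D s \<omega>) (\<tau> + s))) / real (Suc n) \<le>
        (real (Suc n) * g + K) / real (Suc n)"
      by (intro divide_right_mono le) simp
    also have "\<dots> = g + K / real (Suc n)"
      by (simp add: add_divide_distrib)
    finally show "ereal ((\<Sum>s<Suc n. expectation (\<lambda>\<omega>. period_cost h p \<tau> A (\<lambda>s. D s \<omega>) (\<tau> + s))) / real (Suc n))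
        \<le> ereal (g + K / real (Suc n))"
      by simp
  qed
  also have "\<dots> = ereal g"
    by (rule lim_imp_Limsup[OF _ const_plus_over_Suc_tendsto]) simp
  finally show ?thesis .
qed

text \<open>The expected bias at the horizon is bounded on both sides, so its share in the average
  vanishes.\<close>

lemma cost_rate_const_policy:
  assumes hp: "h \<ge> 0" "p \<ge> 0" and r: "0 \<le> r" "r < \<mu>"
  shows "cost_rate M D h p \<tau> (const_policy r) = ereal (const_rate h p \<mu> r)"
proof (rule antisym)
  have le: "\<forall>t. \<forall>x\<in>space (state_space \<tau>). const_policy r t x \<le> r"
    by (simp add: const_policy_def)
  note int = expectation_period_cost(1)[OF const_policy_in_policies[OF r(1)] r(1) le r(2)]
  from const_policy_bias_bounded[OF r] obtain K where
    K: "\<And>\<tau> s. \<bar>expectation (\<lambda>\<omega>. bias h p \<mu> r (prior_inv \<tau> (const_policy r) (\<lambda>s. D s \<omega>) s))\<bar> \<le> K"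
    by metis
  have up: "(\<Sum>s<n. expectation (\<lambda>\<omega>. period_cost h p \<tau> (const_policy r) (\<lambda>s. D s \<omega>) (\<tau> + s)))
      \<le> real n * const_rate h p \<mu> r + K"
    and low: "real n * const_rate h p \<mu> r - K
      \<le> (\<Sum>s<n. expectation (\<lambda>\<omega>. period_cost h p \<tau> (const_policy r) (\<lambda>s. D s \<omega>) (\<tau> + s)))" for n
    using K[of \<tau> "\<tau> + n"] unfolding expectation_sum_const_cost[OF r] by linarith+
  show "cost_rate M D h p \<tau> (const_policy r) \<le> ereal (const_rate h p \<mu> r)"
    by (rule cost_rate_le[OF hp int up])
  have "ereal (const_rate h p \<mu> r) = limsup (\<lambda>n. ereal (const_rate h p \<mu> r + (- K) / real (Suc n)))"
    by (rule lim_imp_Limsup[OF _ const_plus_over_Suc_tendsto, symmetric]) simp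
  also have "\<dots> \<le> cost_rate M D h p \<tau> (const_policy r)"
    unfolding cost_rate_eq_limsup expected_average_cost[OF hp int]
  proof (intro Limsup_mono always_eventually allI)
    fix n
    have "const_rate h p \<mu> r + (- K) / real (Suc n) = (real (Suc n) * const_rate h p \<mu> r - K) / real (Suc n)"
      by (simp add: diff_divide_distrib)
    also have "\<dots> \<le> (\<Sum>s<Suc n. expectation (\<lambda>\<omega>. period_cost h p \<tau> (const_policy r) (\<lambda>s. D s \<omega>) (\<tau> + s))) / real (Suc n)"
      by (intro divide_right_mono low) simp
    finally show "ereal (const_rate h p \<mu> r + (- K) / real (Suc n)) \<le>
      ereal ((\<Sum>s<Suc n. expectation (\<lambda>\<omega>. period_cost h p \<tau> (const_policy r) (\<lambda>s. D s \<omega>) (\<tau> + s))) / real (Suc n))"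
      by simp
  qed
  finally show "ereal (const_rate h p \<mu> r) \<le> cost_rate M D h p \<tau> (const_policy r)" .
qed

section \<open>Policy improvement: the PIL policy\<close>

lemma expected_end_inv_nonneg:
  "x \<in> space (state_space \<tau>) \<Longrightarrow> expected_end_inv M D \<tau> t x \<ge> 0"
  unfolding expected_end_inv_def by (intro integral_nonneg_AE always_eventually allI proj_end_inv_nonneg)

text \<open>Only the first \<open>\<tau>\<close> demands are read, so the path may be replaced by
  its restriction, for which joint measurability in state and demands is known.\<close>

lemma expected_end_inv_measurable [measurable]:
  "expected_end_inv M D \<tau> t \<in> borel_measurable (state_space \<tau>)"
proof -
  have "(\<lambda>z. \<lambda>k\<in>{..<\<tau>}. D (t + k) (snd z)) \<in> state_space \<tau> \<Otimes>\<^sub>M M \<rightarrow>\<^sub>M Pi\<^sub>M {..<\<tau>} (\<lambda>_. borel)"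
    by (intro measurable_restrict) simp
  then have "(\<lambda>z. (fst z, \<lambda>k\<in>{..<\<tau>}. D (t + k) (snd z))) \<in>
      state_space \<tau> \<Otimes>\<^sub>M M \<rightarrow>\<^sub>M state_space \<tau> \<Otimes>\<^sub>M Pi\<^sub>M {..<\<tau>} (\<lambda>_. borel)"
    by (intro measurable_Pair measurable_fst)
  from measurable_compose[OF this proj_end_inv_measurable]
  have "(\<lambda>z. proj_end_inv \<tau> (fst z) (\<lambda>k\<in>{..<\<tau>}. D (t + k) (snd z))) \<in> borel_measurable (state_space \<tau> \<Otimes>\<^sub>M M)"
    by simp
  also have "(\<lambda>z. proj_end_inv \<tau> (fst z) (\<lambda>k\<in>{..<\<tau>}. D (t + k) (snd z))) =
      (\<lambda>(x, \<omega>). proj_end_inv \<tau> x (\<lambda>k. D (t + k) \<omega>))"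
    unfolding case_prod_beta by (intro ext proj_end_inv_cong) auto
  finally show ?thesis
    unfolding expected_end_inv_def by (rule borel_measurable_lebesgue_integral)
qed

lemma pil_policy_in_policies: "pil_policy M D \<tau> U \<in> policies \<tau>"
  unfolding policies_def pil_policy_def by (auto intro!: measurable_nonneg)

lemma pil_policy_le:
  "U \<ge> 0 \<Longrightarrow> \<forall>t. \<forall>x\<in>space (state_space \<tau>). pil_policy M D \<tau> U t x \<le> U"
  using expected_end_inv_nonneg by (auto simp: pil_policy_def)

lemma sys_state_measurable_M [measurable]:
  "A \<in> policies \<tau> \<Longrightarrow> (\<lambda>\<omega>. sys_state \<tau> A (\<lambda>s. D s \<omega>) t) \<in> M \<rightarrow>\<^sub>M state_space \<tau>"
  by (rule past_measurable[OF sys_state_measurable sys_state_cong])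

text \<open>The tower property: a weight that is a function of the state is measurable for the
  sigma-algebra generated by the state, so conditioning can be undone under the integral.\<close>

lemma nn_integral_state_mult_prior_inv:
  fixes t :: nat
  assumes A: "A \<in> policies \<tau>" and w: "w \<in> borel_measurable (state_space \<tau>)"
  defines "X \<equiv> \<lambda>\<omega>. sys_state \<tau> A (\<lambda>s. D s \<omega>) t"
  shows "(\<integral>\<^sup>+\<omega>. w (X \<omega>) * ennreal (prior_inv \<tau> A (\<lambda>s. D s \<omega>) (t + \<tau>)) \<partial>M) =
    (\<integral>\<^sup>+\<omega>. w (X \<omega>) * ennreal (expected_end_inv M D \<tau> t (X \<omega>)) \<partial>M)"
proof -
  define F where "F = vimage_algebra (space M) X (state_space \<tau>)"
  have X: "X \<in> M \<rightarrow>\<^sub>M state_space \<tau>"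
    unfolding X_def by (rule sys_state_measurable_M[OF A])
  have sub: "subalgebra M F"
    unfolding F_def subalgebra_def using X by (auto simp: measurable_iff_sets)
  interpret finite_measure_subalgebra M F
    by unfold_locales (rule sub)
  have XF: "X \<in> F \<rightarrow>\<^sub>M state_space \<tau>"
    unfolding F_def using measurable_space[OF X] by (intro measurable_vimage_algebra1) auto
  have "AE \<omega> in M. D s \<omega> \<ge> 0" for s
    using AE_demand_nonneg by eventually_elim simp
  from nn_cond_exp_end_inv[OF prob_space_axioms indep this A, of t]
  have cond: "AE \<omega> in M. ennreal (expected_end_inv M D \<tau> t (X \<omega>)) =
      nn_cond_exp M F (\<lambda>\<omega>. ennreal (prior_inv \<tau> A (\<lambda>s. D s \<omega>) (t + \<tau>))) \<omega>"
    by (simp add: X_def F_def)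
  have "(\<integral>\<^sup>+\<omega>. w (X \<omega>) * ennreal (expected_end_inv M D \<tau> t (X \<omega>)) \<partial>M) =
      (\<integral>\<^sup>+\<omega>. w (X \<omega>) * nn_cond_exp M F (\<lambda>\<omega>. ennreal (prior_inv \<tau> A (\<lambda>s. D s \<omega>) (t + \<tau>))) \<omega> \<partial>M)"
    using cond by (intro nn_integral_cong_AE) (auto elim!: eventually_mono)
  also have "\<dots> = (\<integral>\<^sup>+\<omega>. w (X \<omega>) * ennreal (prior_inv \<tau> A (\<lambda>s. D s \<omega>) (t + \<tau>)) \<partial>M)"
    using A by (intro nn_cond_exp_intg measurable_compose[OF XF w]) simp
  finally show ?thesis by simp
qed

text \<open>In products with a bounded function of the state, such as the order placed in period
  \<open>t\<close>, the inventory met by that order may be replaced by its projection. Integrability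
  of the projected product comes from the equality of the nonnegative integrals, not from a
  bound.\<close>

lemma expectation_state_mult_prior_inv:
  fixes t :: nat
  assumes A: "A \<in> policies \<tau>" and B: "B \<ge> 0" "\<forall>t. \<forall>x\<in>space (state_space \<tau>). A t x \<le> B"
    and w [measurable]: "w \<in> borel_measurable (state_space \<tau>)"
    and wb: "\<And>x. x \<in> space (state_space \<tau>) \<Longrightarrow> 0 \<le> w x \<and> w x \<le> C"
  defines "X \<equiv> \<lambda>\<omega>. sys_state \<tau> A (\<lambda>s. D s \<omega>) t"
  shows "integrable M (\<lambda>\<omega>. w (X \<omega>) * prior_inv \<tau> A (\<lambda>s. D s \<omega>) (t + \<tau>))"
    and "integrable M (\<lambda>\<omega>. w (X \<omega>) * expected_end_inv M D \<tau> t (X \<omega>))"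
    and "expectation (\<lambda>\<omega>. w (X \<omega>) * prior_inv \<tau> A (\<lambda>s. D s \<omega>) (t + \<tau>)) =
      expectation (\<lambda>\<omega>. w (X \<omega>) * expected_end_inv M D \<tau> t (X \<omega>))"
proof -
  let ?y = "\<lambda>\<omega>. prior_inv \<tau> A (\<lambda>s. D s \<omega>) (t + \<tau>)" and ?m = "\<lambda>\<omega>. expected_end_inv M D \<tau> t (X \<omega>)"
  have [measurable]: "X \<in> M \<rightarrow>\<^sub>M state_space \<tau>" "?y \<in> borel_measurable M"
    using A by (simp_all add: X_def)
  have Xs: "X \<omega> \<in> space (state_space \<tau>)" for \<omega>
    using sys_state_in_space[OF A] by (simp add: X_def)
  have nn: "w (X \<omega>) \<ge> 0" "?m \<omega> \<ge> 0" "?y \<omega> \<ge> 0" for \<omega>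
    using wb[OF Xs] expected_end_inv_nonneg[OF Xs] prior_inv_nonneg by auto
  show iy: "integrable M (\<lambda>\<omega>. w (X \<omega>) * ?y \<omega>)"
  proof (rule integrable_const_bound)
    show "AE \<omega> in M. norm (w (X \<omega>) * ?y \<omega>) \<le> C * (real (t + \<tau>) * B)"
      using AE_system_bounds(1)[OF A B, of "t + \<tau>"]
    proof eventually_elim
      case (elim \<omega>)
      have "w (X \<omega>) * ?y \<omega> \<le> C * (real (t + \<tau>) * B)"
        using elim wb[OF Xs, of \<omega>] nn[of \<omega>] by (intro mult_mono) auto
      then show ?case using nn by (simp add: abs_mult)
    qed
  qed simp
  have eq: "(\<integral>\<^sup>+\<omega>. ennreal (w (X \<omega>) * ?y \<omega>) \<partial>M) = (\<integral>\<^sup>+\<omega>. ennreal (w (X \<omega>) * ?m \<omega>) \<partial>M)"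
    using nn_integral_state_mult_prior_inv[OF A, of "\<lambda>x. ennreal (w x)" t]
    by (simp add: ennreal_mult nn) (simp add: X_def)
  show "integrable M (\<lambda>\<omega>. w (X \<omega>) * ?m \<omega>)"
    using nn by (intro integrableI_nonneg)
      (auto simp: eq[symmetric] nn_integral_eq_integral[OF iy])
  show "expectation (\<lambda>\<omega>. w (X \<omega>) * ?y \<omega>) = expectation (\<lambda>\<omega>. w (X \<omega>) * ?m \<omega>)"
    using nn by (simp add: integral_eq_nn_integral eq)
qed

text \<open>
  Conditionally on the state, the change of the bias is a quadratic function of the order quantity
  that vanishes at \<open>r\<close> and whose minimizer over \<open>{0..}\<close> is the order quantity of
  \<open>pil_policy M D \<tau> (p * (\<mu> - r) / h)\<close>: this policy is a one-step improvement of \<open>const_policy r\<close>.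
\<close>

lemma pil_policy_improvement:
  assumes h: "h > 0" and p: "p > 0" and r: "0 \<le> r" "r < \<mu>" and s: "s \<ge> \<tau>"
  defines "A \<equiv> pil_policy M D \<tau> (p * (\<mu> - r) / h)"
  shows "expectation (\<lambda>\<omega>. (order_qty \<tau> A (\<lambda>s. D s \<omega>) s - r) *
    (h / (2 * (\<mu> - r)) * (2 * prior_inv \<tau> A (\<lambda>s. D s \<omega>) s + order_qty \<tau> A (\<lambda>s. D s \<omega>) s + r) - p)) \<le> 0"
proof -
  define U where "U = p * (\<mu> - r) / h"
  define a where "a = h / (2 * (\<mu> - r))"
  \<comment> \<open>\<open>p = 2 * a * U\<close> holds by the choice of \<open>U\<close>; it makes
    \<open>q + m = U\<close> the stationary point of the quadratic in \<open>q\<close>.\<close>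
  have U: "U \<ge> 0" and a: "a > 0" and p_eq: "p = 2 * a * U"
    using h p r by (simp_all add: U_def a_def nonzero_eq_divide_eq)
  have A: "A \<in> policies \<tau>" and B: "\<forall>t. \<forall>x\<in>space (state_space \<tau>). A t x \<le> U"
    unfolding A_def U_def[symmetric] by (rule pil_policy_in_policies, rule pil_policy_le[OF U])
  define t where "t = s - \<tau>"
  have st: "s = t + \<tau>" using s by (simp add: t_def)
  define X where "X = (\<lambda>\<omega>. sys_state \<tau> A (\<lambda>s. D s \<omega>) t)"
  have [measurable]: "X \<in> M \<rightarrow>\<^sub>M state_space \<tau>"
    using A by (simp add: X_def)
  have [measurable]: "A t \<in> borel_measurable (state_space \<tau>)"
    using A by (auto simp: policies_def dest: measurable_nonnegD)
  have Xs: "X \<omega> \<in> space (state_space \<tau>)" for \<omega>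
    using sys_state_in_space[OF A] by (simp add: X_def)
  define y where "y = (\<lambda>\<omega>. prior_inv \<tau> A (\<lambda>s. D s \<omega>) (t + \<tau>))"
  define q where "q = (\<lambda>\<omega>. A t (X \<omega>))"
  define m where "m = (\<lambda>\<omega>. expected_end_inv M D \<tau> t (X \<omega>))"
  have [measurable]: "q \<in> borel_measurable M"
    by (simp add: q_def)
  have q: "0 \<le> q \<omega>" "q \<omega> \<le> U" "q \<omega> = max 0 (U - m \<omega>)" for \<omega>
    using policy_nonneg[OF A Xs] B Xs unfolding q_def
    by (auto simp: m_def A_def pil_policy_def U_def)
  have m: "0 \<le> m \<omega>" for \<omega>
    using expected_end_inv_nonneg[OF Xs] by (simp add: m_def)
  have E1: "integrable M y" "integrable M m" "expectation y = expectation m"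
    using expectation_state_mult_prior_inv[OF A U B, of "\<lambda>_. 1" 1 t]
    by (simp_all add: y_def m_def X_def)
  have "0 \<le> A t x \<and> A t x \<le> U" if "x \<in> space (state_space \<tau>)" for x
    using that policy_nonneg[OF A] B by auto
  then have Eq: "integrable M (\<lambda>\<omega>. q \<omega> * y \<omega>)" "integrable M (\<lambda>\<omega>. q \<omega> * m \<omega>)"
      "expectation (\<lambda>\<omega>. q \<omega> * y \<omega>) = expectation (\<lambda>\<omega>. q \<omega> * m \<omega>)"
    using expectation_state_mult_prior_inv[OF A U B, of "A t" U t]
    by (simp_all add: y_def m_def q_def X_def)
  let ?e = "\<lambda>\<omega>. (q \<omega> - r) * (a * (q \<omega> + r) - p)"
  have ie: "integrable M ?e"
  proof (rule integrable_const_bound)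
    show "AE \<omega> in M. norm (?e \<omega>) \<le> (U + r) * (a * (U + r) + p)"
    proof (intro always_eventually allI)
      fix \<omega>
      have "\<bar>q \<omega> - r\<bar> \<le> U + r" using q(1,2)[of \<omega>] r by auto
      moreover have "\<bar>a * (q \<omega> + r) - p\<bar> \<le> a * (U + r) + p"
      proof -
        have "a * (q \<omega> + r) \<le> a * (U + r)" "a * (q \<omega> + r) \<ge> 0"
          using q(1,2)[of \<omega>] a r by auto
        then show ?thesis using p by auto
      qed
      ultimately show "norm (?e \<omega>) \<le> (U + r) * (a * (U + r) + p)"
        using U r by (simp add: abs_mult mult_mono)
    qed
  qed simp
  have "expectation (\<lambda>\<omega>. (q \<omega> - r) * (a * (2 * y \<omega> + q \<omega> + r) - p)) =
      expectation (\<lambda>\<omega>. 2 * a * (q \<omega> * y \<omega>) - 2 * a * r * y \<omega> + ?e \<omega>)"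
    by (rule arg_cong[where f = "integral\<^sup>L M"]) (auto simp: algebra_simps)
  \<comment> \<open>The defect is linear in \<open>y\<close> with coefficients that depend on the
    state alone, so \<open>y\<close> may be exchanged for its projection \<open>m\<close>.\<close>
  also have "\<dots> = expectation (\<lambda>\<omega>. 2 * a * (q \<omega> * m \<omega>) - 2 * a * r * m \<omega> + ?e \<omega>)"
    using E1 Eq ie by simp
  also have "\<dots> \<le> 0"
  proof -
    have nonpos: "2 * a * (q \<omega> * m \<omega>) - 2 * a * r * m \<omega> + ?e \<omega> \<le> 0" for \<omega>
    proof -
      have "2 * a * (q \<omega> * m \<omega>) - 2 * a * r * m \<omega> + ?e \<omega> =
          a * ((q \<omega> - r) * (2 * m \<omega> + q \<omega> + r - 2 * U))"
        by (simp add: p_eq algebra_simps)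
      \<comment> \<open>If \<open>m \<le> U\<close>, the order lifts the projection to
        \<open>U\<close> and the product is \<open>- (q - r)\<^sup>2\<close>; otherwise nothing is
        ordered and it is \<open>- r * (2 * (m - U) + r)\<close>.\<close>
      also have "(q \<omega> - r) * (2 * m \<omega> + q \<omega> + r - 2 * U) \<le> 0"
      proof (cases "m \<omega> \<le> U")
        case True
        then have "U = m \<omega> + q \<omega>"
          using q(3)[of \<omega>] by simp
        then have "(q \<omega> - r) * (2 * m \<omega> + q \<omega> + r - 2 * U) = - (q \<omega> - r)\<^sup>2"
          by (simp add: power2_eq_square algebra_simps)
        then show ?thesis by simp
      next
        case False
        then show ?thesis using q(3)[of \<omega>] r by (auto intro!: mult_nonneg_nonneg)
      qed
      then have "a * ((q \<omega> - r) * (2 * m \<omega> + q \<omega> + r - 2 * U)) \<le> 0"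
        using a by (simp add: mult_le_0_iff)
      finally show ?thesis .
    qed
    have "0 \<le> expectation (\<lambda>\<omega>. - (2 * a * (q \<omega> * m \<omega>) - 2 * a * r * m \<omega> + ?e \<omega>))"
      by (intro integral_nonneg_AE always_eventually allI) (simp only: neg_0_le_iff_le nonpos)
    then show ?thesis by (simp only: integral_minus neg_0_le_iff_le)
  qed
  finally show ?thesis
    unfolding st a_def y_def q_def X_def by (simp add: order_qty_eq_policy)
qed

lemma cost_rate_pil_policy_le:
  assumes h: "h > 0" and p: "p > 0" and r: "0 \<le> r" "r < \<mu>"
  shows "cost_rate M D h p \<tau> (pil_policy M D \<tau> (p * (\<mu> - r) / h)) \<le> ereal (const_rate h p \<mu> r)"
proof -
  let ?A = "pil_policy M D \<tau> (p * (\<mu> - r) / h)"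
  have U: "p * (\<mu> - r) / h \<ge> 0" using h p r by simp
  note A = pil_policy_in_policies[of \<tau> "p * (\<mu> - r) / h"] U pil_policy_le[OF U]
  obtain K where K: "\<And>y. bias h p \<mu> r y \<ge> - K"
    using bias_lower[OF h r(2)] by metis
  have "- K \<le> expectation (\<lambda>\<omega>. bias h p \<mu> r (prior_inv \<tau> ?A (\<lambda>s. D s \<omega>) n))" for n
  proof (cases "integrable M (\<lambda>\<omega>. bias h p \<mu> r (prior_inv \<tau> ?A (\<lambda>s. D s \<omega>) n))")
    case True
    then have "expectation (\<lambda>_. - K) \<le> expectation (\<lambda>\<omega>. bias h p \<mu> r (prior_inv \<tau> ?A (\<lambda>s. D s \<omega>) n))"
      using K by (intro integral_mono) auto
    then show ?thesis by (simp add: prob_space)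
  next
    case False
    \<comment> \<open>The expectation of a non-integrable function is 0, which is also the bias at
      0.\<close>
    have "- K \<le> bias h p \<mu> r 0" by (rule K)
    then show ?thesis using False by (simp add: not_integrable_integral_eq)
  qed
  note bias_ge = this
  have "(\<Sum>s<n. expectation (\<lambda>\<omega>. period_cost h p \<tau> ?A (\<lambda>s. D s \<omega>) (\<tau> + s))) \<le>
      real n * const_rate h p \<mu> r + K" for n
    using bias_ge[of "\<tau> + n"] expectation_sum_cost_le[OF A r(2) pil_policy_improvement[OF h p r], of n]
    by simp
  then show ?thesis
    using h p by (intro cost_rate_le expectation_period_cost(1)[OF A r(2)]) auto
qed

end

section \<open>Sample-path convexity of the inventory in the orders\<close>

text \<open>Lead time 0 makes \<open>r\<close> arrive in every period from 0 on: this is the end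
  inventory after \<open>n\<close> periods of a system that starts empty, to be run on shifted
  demand paths.\<close>

abbreviation const_inv :: "real \<Rightarrow> (nat \<Rightarrow> real) \<Rightarrow> nat \<Rightarrow> real" where
  "const_inv r d n \<equiv> prior_inv 0 (const_policy r) d n"

text \<open>
  The derivative with respect to the \<open>k\<close>-th order: an additional unit survives to period \<open>n\<close> iff
  the inventory does not run out in between.
\<close>

definition const_inv_deriv :: "real \<Rightarrow> (nat \<Rightarrow> real) \<Rightarrow> nat \<Rightarrow> nat \<Rightarrow> real" where
  "const_inv_deriv r d n k = (\<Prod>i\<in>{k<..n}. if const_inv r d i > 0 then 1 else 0)"

lemma const_inv_Suc: "const_inv r d (Suc n) = max 0 (const_inv r d n + r - d n)"
  by (simp add: prior_inv_Suc order_qty_const)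

lemma const_inv_deriv_bounds: "0 \<le> const_inv_deriv r d n k" "const_inv_deriv r d n k \<le> 1"
  unfolding const_inv_deriv_def by (auto intro!: prod_nonneg prod_le_1)

lemma const_inv_deriv_Suc:
  "k \<le> n \<Longrightarrow> const_inv_deriv r d (Suc n) k =
    (if const_inv r d (Suc n) > 0 then const_inv_deriv r d n k else 0)"
proof -
  assume "k \<le> n"
  then have "{k<..Suc n} = insert (Suc n) {k<..n}" by auto
  then show ?thesis by (simp add: const_inv_deriv_def)
qed

text \<open>
  The inventory is a convex function of the orders, and \<open>const_inv_deriv\<close> is a subgradient at the
  constant orders \<open>r\<close>.
\<close>

lemma prior_inv_ge_subgradient:
  "const_inv r (\<lambda>k. d (t + k)) n +
    (\<Sum>k<n. const_inv_deriv r (\<lambda>k. d (t + k)) n k * (order_qty \<tau> A d (t + k) - r))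
    \<le> prior_inv \<tau> A d (t + n)"
proof (induction n)
  case 0
  then show ?case by (simp add: prior_inv_0 prior_inv_nonneg)
next
  case (Suc n)
  let ?e = "\<lambda>k. d (t + k)" and ?x = "\<lambda>k. order_qty \<tau> A d (t + k) - r"
  \<comment> \<open>If no stock is left after the last period, all weights vanish and the left-hand
    side is 0; otherwise the newest order enters with weight 1.\<close>
  have sum: "(\<Sum>k<Suc n. const_inv_deriv r ?e (Suc n) k * ?x k) =
      (if const_inv r ?e (Suc n) > 0 then (\<Sum>k<n. const_inv_deriv r ?e n k * ?x k) + ?x n else 0)"
  proof -
    have "const_inv_deriv r ?e n n = 1" by (simp add: const_inv_deriv_def)
    then show ?thesis by (simp add: const_inv_deriv_Suc)
  qed
  show ?case
  proof (cases "const_inv r ?e (Suc n) > 0")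
    case True
    then have "const_inv r ?e (Suc n) = const_inv r ?e n + r - d (t + n)"
      by (auto simp: const_inv_Suc max_def split: if_splits)
    then show ?thesis
      unfolding sum using Suc True by (simp add: prior_inv_Suc)
  next
    case False
    then have "const_inv r ?e (Suc n) = 0"
      using prior_inv_nonneg[of 0 "const_policy r" ?e "Suc n"] by simp
    then show ?thesis unfolding sum by (simp add: prior_inv_nonneg)
  qed
qed

lemma const_inv_mono:
  assumes "r \<le> r'"
  shows "const_inv r d n \<le> const_inv r' d n"
  using assms by (induction n) (auto simp: prior_inv_0 const_inv_Suc)

text \<open>Both systems face the same demands from period 1 on, and the later one starts empty,
  hence not above the other.\<close>

lemma const_inv_shift_le: "const_inv r (\<lambda>k. d (1 + k)) n \<le> const_inv r d (Suc n)"
proof (induction n)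
  case (Suc n)
  then show ?case
    by (subst (2) const_inv_Suc, subst const_inv_Suc) simp
qed (simp add: prior_inv_0 prior_inv_nonneg)

lemma const_inv_measurable:
  assumes "{t..<t + n} \<subseteq> I" "i \<le> n"
  shows "(\<lambda>d. const_inv r (\<lambda>k. d (t + k)) i) \<in> borel_measurable (Pi\<^sub>M I (\<lambda>_. borel))"
  using assms(2)
proof (induction i)
  case (Suc i)
  then have "(\<lambda>d. d (t + i)) \<in> borel_measurable (Pi\<^sub>M I (\<lambda>_. borel))"
    using assms(1) by (intro measurable_component_singleton) auto
  then show ?case
    using Suc unfolding const_inv_Suc by (intro borel_measurable_max borel_measurable_diff borel_measurable_add) auto
qed (simp add: prior_inv_0)

lemma const_inv_deriv_measurable:
  assumes "{t..<t + n} \<subseteq> I"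
  shows "(\<lambda>d. const_inv_deriv r (\<lambda>k. d (t + k)) n k) \<in> borel_measurable (Pi\<^sub>M I (\<lambda>_. borel))"
  unfolding const_inv_deriv_def
proof (intro borel_measurable_prod)
  fix i assume "i \<in> {k<..n}"
  then have [measurable]: "(\<lambda>d. const_inv r (\<lambda>k. d (t + k)) i) \<in> borel_measurable (Pi\<^sub>M I (\<lambda>_. borel))"
    by (intro const_inv_measurable[OF assms]) auto
  show "(\<lambda>d. if const_inv r (\<lambda>k. d (t + k)) i > 0 then 1 else 0 :: real) \<in> borel_measurable (Pi\<^sub>M I (\<lambda>_. borel))"
    by measurable
qed

lemma const_inv_deriv_cong:
  assumes "\<And>i. i < n \<Longrightarrow> d i = d' i"
  shows "const_inv_deriv r d n k = const_inv_deriv r d' n k"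
proof -
  have "const_inv r d i = const_inv r d' i" if "i \<in> {k<..n}" for i
    using that assms sample_path_cong[of i d d' i 0 "const_policy r"] by auto
  then show ?thesis
    unfolding const_inv_deriv_def by (intro prod.cong) simp_all
qed

lemma lost_sales_balance: "lost_sales \<tau> A d s = d s - order_qty \<tau> A d s - prior_inv \<tau> A d s + prior_inv \<tau> A d (Suc s)"
  by (simp add: lost_sales_def prior_inv_Suc inv_level.simps[of _ _ _ s])

text \<open>Material balance: over the first \<open>N\<close> periods, demands minus orders equal
  lost sales minus remaining stock. Costs are instead counted over \<open>N\<close> periods from
  \<open>\<tau>\<close> on; the lost sales before \<open>\<tau>\<close> are at most the demands
  there.\<close>

lemma sum_lost_sales_ge:
  assumes A: "A \<in> policies \<tau>" and d: "\<And>i. d i \<ge> 0"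
  shows "(\<Sum>s<N. d s - order_qty \<tau> A d s) - (\<Sum>s<\<tau>. d s) \<le> (\<Sum>s<N. lost_sales \<tau> A d (\<tau> + s))"
proof -
  have L: "0 \<le> lost_sales \<tau> A d s" "lost_sales \<tau> A d s \<le> d s" for s
    using inv_level_nonneg[OF A, of d s] d[of s] by (auto simp: lost_sales_def)
  have "(\<Sum>s<N. d s - order_qty \<tau> A d s) + prior_inv \<tau> A d N = (\<Sum>s<N. lost_sales \<tau> A d s)"
    by (induction N) (auto simp: lost_sales_balance prior_inv_0)
  then have "(\<Sum>s<N. d s - order_qty \<tau> A d s) \<le> (\<Sum>s<N. lost_sales \<tau> A d s)"
    using prior_inv_nonneg[of \<tau> A d N] by linarith
  also have "\<dots> \<le> (\<Sum>s<\<tau> + N. lost_sales \<tau> A d s)"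
    using L by (intro sum_mono2) auto
  also have "\<dots> = (\<Sum>s<\<tau>. lost_sales \<tau> A d s) + (\<Sum>s<N. lost_sales \<tau> A d (\<tau> + s))"
    by (induction N) auto
  also have "(\<Sum>s<\<tau>. lost_sales \<tau> A d s) \<le> (\<Sum>s<\<tau>. d s)"
    using L by (intro sum_mono) auto
  finally show ?thesis by simp
qed

section \<open>Mean inventory under constant orders, and Jensen's inequality\<close>

context exponential_demand
begin

text \<open>The quantity \<open>\<phi>\<^sub>n(r)\<close> of the overview.\<close>

definition mean_const_inv :: "real \<Rightarrow> nat \<Rightarrow> real" where
  "mean_const_inv r n = expectation (\<lambda>\<omega>. const_inv r (\<lambda>k. D k \<omega>) n)"

text \<open>The law of an i.i.d. sequence is a product measure in which the starting index
  \<open>t\<close> no longer occurs; windows of demand can therefore be moved to time 0.\<close>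

lemma distr_shifted_demand:
  "distr M (Pi\<^sub>M UNIV (\<lambda>_. borel)) (\<lambda>\<omega> k. D (t + k) \<omega>) =
    Pi\<^sub>M UNIV (\<lambda>_. density lborel (exponential_density (1 / \<mu>)))"
proof -
  have "indep_vars (\<lambda>k. Pi\<^sub>M {t + k} (\<lambda>_. borel)) (\<lambda>k \<omega>. restrict (\<lambda>i. D i \<omega>) {t + k}) UNIV"
    by (rule indep_vars_restrict[OF indep]) (auto simp: disjoint_family_on_def)
  then have "indep_vars (\<lambda>_. borel) (\<lambda>k \<omega>. (restrict (\<lambda>i. D i \<omega>) {t + k}) (t + k)) UNIV"
    by (rule indep_vars_compose2) (intro measurable_component_singleton, simp)
  then have "indep_vars (\<lambda>_. borel) (\<lambda>k. D (t + k)) UNIV" by simp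
  then have "distr M (Pi\<^sub>M UNIV (\<lambda>_. borel)) (\<lambda>\<omega>. \<lambda>k\<in>UNIV. D (t + k) \<omega>) =
      Pi\<^sub>M UNIV (\<lambda>k. distr M borel (D (t + k)))"
    by (subst (asm) indep_vars_iff_distr_eq_PiM) auto
  moreover have "distr M borel (D (t + k)) = density lborel (exponential_density (1 / \<mu>))" for k
    using distributed_distr_eq_density[OF distr_D, of "t + k"] by (simp cong: distr_cong)
  ultimately show ?thesis by (simp add: restrict_UNIV)
qed

lemma expectation_shifted_demand:
  assumes f: "f \<in> borel_measurable (Pi\<^sub>M UNIV (\<lambda>_. borel))"
  shows "expectation (\<lambda>\<omega>. f (\<lambda>k. D (t + k) \<omega>) :: real) = expectation (\<lambda>\<omega>. f (\<lambda>k. D k \<omega>))"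
proof -
  have *: "expectation (\<lambda>\<omega>. f (\<lambda>k. D (t + k) \<omega>)) =
      integral\<^sup>L (Pi\<^sub>M UNIV (\<lambda>_. density lborel (exponential_density (1 / \<mu>)))) f" for t
    unfolding distr_shifted_demand[of t, symmetric]
    by (rule integral_distr[OF _ f, symmetric]) (auto intro: measurable_PiM_single')
  show ?thesis using *[of t] *[of 0] by simp
qed

lemma const_inv_measurable_M [measurable]: "(\<lambda>\<omega>. const_inv r (\<lambda>k. D (t + k) \<omega>) n) \<in> borel_measurable M"
proof -
  have "(\<lambda>\<omega> k. D (t + k) \<omega>) \<in> M \<rightarrow>\<^sub>M Pi\<^sub>M UNIV (\<lambda>_. borel)"
    by (rule measurable_PiM_single') auto
  from measurable_compose[OF this const_inv_measurable[of 0 n UNIV n r]] show ?thesis by simp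
qed

lemma const_inv_deriv_measurable_M [measurable]:
  "(\<lambda>\<omega>. const_inv_deriv r (\<lambda>k. D (t + k) \<omega>) n k) \<in> borel_measurable M"
proof -
  have "(\<lambda>\<omega> k. D (t + k) \<omega>) \<in> M \<rightarrow>\<^sub>M Pi\<^sub>M UNIV (\<lambda>_. borel)"
    by (rule measurable_PiM_single') auto
  from measurable_compose[OF this const_inv_deriv_measurable[of 0 n UNIV r k]] show ?thesis by simp
qed

lemma const_inv_integrable:
  assumes "r \<ge> 0"
  shows "integrable M (\<lambda>\<omega>. const_inv r (\<lambda>k. D (t + k) \<omega>) n)"
proof (rule integrable_const_bound)
  have le: "\<forall>t. \<forall>x\<in>space (state_space 0). const_policy r t x \<le> r"
    by (simp add: const_policy_def)
  show "AE \<omega> in M. norm (const_inv r (\<lambda>k. D (t + k) \<omega>) n) \<le> real n * r"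
    using AE_demand_nonneg
  proof eventually_elim
    case (elim \<omega>)
    then show ?case
      using prior_inv_le[OF const_policy_in_policies[OF assms] assms le, of "\<lambda>k. D (t + k) \<omega>" n]
      by (simp add: prior_inv_nonneg)
  qed
qed simp

lemma expectation_const_inv:
  "expectation (\<lambda>\<omega>. const_inv r (\<lambda>k. D (t + k) \<omega>) n) = mean_const_inv r n"
  unfolding mean_const_inv_def
  using expectation_shifted_demand[OF const_inv_measurable[of 0 n UNIV n r], of t] by simp

lemma mean_const_inv_mono: "0 \<le> r \<Longrightarrow> r \<le> r' \<Longrightarrow> mean_const_inv r n \<le> mean_const_inv r' n"
  unfolding mean_const_inv_def
  using const_inv_integrable[of _ 0] by (intro integral_mono const_inv_mono) auto

text \<open>Dropping the first period does not raise the inventory on any path, and by stationarity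
  the shortened system has the mean of \<open>n\<close> periods started at time 0.\<close>

lemma incseq_mean_const_inv:
  assumes "r \<ge> 0"
  shows "incseq (mean_const_inv r)"
proof (rule incseq_SucI)
  fix n
  have "expectation (\<lambda>\<omega>. const_inv r (\<lambda>k. D (1 + k) \<omega>) n) \<le> expectation (\<lambda>\<omega>. const_inv r (\<lambda>k. D k \<omega>) (Suc n))"
    using const_inv_integrable[OF assms, of 0] const_inv_integrable[OF assms, of 1 n]
      const_inv_shift_le[of r "\<lambda>k. D k _" n]
    by (intro integral_mono) auto
  then show "mean_const_inv r n \<le> mean_const_inv r (Suc n)"
    unfolding expectation_const_inv[of r 1 n] by (simp add: mean_const_inv_def)
qed

text \<open>For \<open>h = 1\<close> and \<open>p = 0\<close> the telescoped cost is the sum of the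
  mean inventories. These increase with time, so the last one dominates their average, which is
  within \<open>K / real (Suc n)\<close> of \<open>r\<^sup>2 / (2 * (\<mu> - r))\<close>.\<close>

lemma mean_const_inv_lower:
  assumes r: "0 \<le> r" "r < \<mu>"
  obtains K where "\<And>n. mean_const_inv r (Suc n) \<ge> r\<^sup>2 / (2 * (\<mu> - r)) - K / real (Suc n)"
proof -
  from const_policy_bias_bounded[OF r] obtain K where
    K: "\<And>\<tau> s. \<bar>expectation (\<lambda>\<omega>. bias 1 0 \<mu> r (prior_inv \<tau> (const_policy r) (\<lambda>s. D s \<omega>) s))\<bar> \<le> K"
    by metis
  have "mean_const_inv r (Suc n) \<ge> r\<^sup>2 / (2 * (\<mu> - r)) - K / real (Suc n)" for n
  proof -
    have "real (Suc n) * (r\<^sup>2 / (2 * (\<mu> - r))) - K \<le>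
        (\<Sum>s<Suc n. expectation (\<lambda>\<omega>. period_cost 1 0 0 (const_policy r) (\<lambda>s. D s \<omega>) (0 + s)))"
      using K[of 0 "0 + Suc n"] unfolding expectation_sum_const_cost[OF r] by (simp add: const_rate_def)
    also have "\<dots> = (\<Sum>s<Suc n. mean_const_inv r (Suc s))"
      by (simp add: period_cost_def end_inv_eq mean_const_inv_def)
    also have "\<dots> \<le> (\<Sum>s<Suc n. mean_const_inv r (Suc n))"
      by (intro sum_mono incseqD[OF incseq_mean_const_inv[OF r(1)]]) simp
    also have "\<dots> = real (Suc n) * mean_const_inv r (Suc n)" by simp
    finally have "(real (Suc n) * (r\<^sup>2 / (2 * (\<mu> - r))) - K) / real (Suc n) \<le> mean_const_inv r (Suc n)"
      by (subst pos_divide_le_eq) (simp_all add: mult.commute)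
    then show ?thesis by (simp add: diff_divide_distrib)
  qed
  then show thesis by (rule that)
qed

text \<open>Orders arriving up to period \<open>t + \<tau>\<close> are functions of the demands
  before \<open>t\<close>, while the weights read the demands from \<open>t\<close> on: the expected
  products factor. Stationarity makes the mean weights independent of \<open>t\<close>, so the
  inequality can be summed over \<open>t\<close>.\<close>

lemma expectation_prior_inv_ge:
  assumes A: "A \<in> policies \<tau>" and r: "r \<ge> 0"
    and iq: "\<And>k. k \<le> \<tau> \<Longrightarrow> integrable M (\<lambda>\<omega>. order_qty \<tau> A (\<lambda>s. D s \<omega>) (t + k))"
    and iJ: "integrable M (\<lambda>\<omega>. prior_inv \<tau> A (\<lambda>s. D s \<omega>) (t + Suc \<tau>))"
  shows "mean_const_inv r (Suc \<tau>) + (\<Sum>k\<le>\<tau>. expectation (\<lambda>\<omega>. const_inv_deriv r (\<lambda>k. D k \<omega>) (Suc \<tau>) k) *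
      (expectation (\<lambda>\<omega>. order_qty \<tau> A (\<lambda>s. D s \<omega>) (t + k)) - r))
    \<le> expectation (\<lambda>\<omega>. prior_inv \<tau> A (\<lambda>s. D s \<omega>) (t + Suc \<tau>))"
proof -
  define w where "w = (\<lambda>k \<omega>. const_inv_deriv r (\<lambda>k. D (t + k) \<omega>) (Suc \<tau>) k)"
  define q where "q = (\<lambda>k \<omega>. order_qty \<tau> A (\<lambda>s. D s \<omega>) (t + k))"
  have [measurable]: "w k \<in> borel_measurable M" for k by (simp add: w_def)
  have iw: "integrable M (w k)" for k
    using const_inv_deriv_bounds by (intro integrable_const_bound[of _ 1]) (auto simp: w_def)
  have Ew: "expectation (w k) = expectation (\<lambda>\<omega>. const_inv_deriv r (\<lambda>k. D k \<omega>) (Suc \<tau>) k)" for k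
    unfolding w_def
    using expectation_shifted_demand[OF const_inv_deriv_measurable[of 0 "Suc \<tau>" UNIV r k], of t] by simp
  have ind: "indep_var borel (q k) borel (w k)" if k: "k \<le> \<tau>" for k
    unfolding q_def w_def
  proof (rule indep_past_future[where m = "t + Suc \<tau>" and g = "\<lambda>d. order_qty \<tau> A d (t + k)"
        and f = "\<lambda>d. const_inv_deriv r (\<lambda>k. d (t + k)) (Suc \<tau>) k" and n = t])
    show "(\<lambda>d. order_qty \<tau> A d (t + k)) \<in> borel_measurable (Pi\<^sub>M {..<t} (\<lambda>_. borel))"
      using sample_path_measurable[OF A, of "t + k" t] k by (auto dest: measurable_nonnegD(1))
    show "order_qty \<tau> A d (t + k) = order_qty \<tau> A d' (t + k)" if "\<And>i. i < t \<Longrightarrow> d i = d' i" for d d'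
      using sample_path_cong[of t d d' "t + k" \<tau> A] k that by auto
    show "(\<lambda>d. const_inv_deriv r (\<lambda>k. d (t + k)) (Suc \<tau>) k) \<in> borel_measurable (Pi\<^sub>M {t..<t + Suc \<tau>} (\<lambda>_. borel))"
      by (rule const_inv_deriv_measurable) simp
    show "const_inv_deriv r (\<lambda>k. d (t + k)) (Suc \<tau>) k = const_inv_deriv r (\<lambda>k. d' (t + k)) (Suc \<tau>) k"
      if "\<And>i. t \<le> i \<Longrightarrow> i < t + Suc \<tau> \<Longrightarrow> d i = d' i" for d d'
      using that by (intro const_inv_deriv_cong) auto
  qed
  have iqw: "integrable M (\<lambda>\<omega>. q k \<omega> * w k \<omega>)"
    and Eqw: "expectation (\<lambda>\<omega>. q k \<omega> * w k \<omega>) = expectation (q k) * expectation (w k)" if k: "k \<le> \<tau>" for k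
    using indep_var_integrable[OF ind[OF k] _ iw] indep_var_lebesgue_integral[OF ind[OF k] _ iw] iq[OF k]
    by (simp_all add: q_def)
  have iwx: "integrable M (\<lambda>\<omega>. w k \<omega> * (q k \<omega> - r))" if k: "k \<le> \<tau>" for k
    using iqw[OF k] iw[of k] by (simp add: algebra_simps)
  have Ewx: "expectation (\<lambda>\<omega>. w k \<omega> * (q k \<omega> - r)) = expectation (w k) * (expectation (q k) - r)" if k: "k \<le> \<tau>" for k
    using iqw[OF k] iw[of k] Eqw[OF k] by (simp add: algebra_simps)
  let ?R = "\<lambda>\<omega>. const_inv r (\<lambda>k. D (t + k) \<omega>) (Suc \<tau>)"
  have isum: "integrable M (\<lambda>\<omega>. \<Sum>k\<le>\<tau>. w k \<omega> * (q k \<omega> - r))"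
    by (intro Bochner_Integration.integrable_sum iwx) auto
  have "expectation (\<lambda>\<omega>. \<Sum>k\<le>\<tau>. w k \<omega> * (q k \<omega> - r)) =
      (\<Sum>k\<le>\<tau>. expectation (\<lambda>\<omega>. w k \<omega> * (q k \<omega> - r)))"
    by (intro Bochner_Integration.integral_sum iwx) auto
  also have "\<dots> = (\<Sum>k\<le>\<tau>. expectation (w k) * (expectation (q k) - r))"
    by (intro sum.cong Ewx) auto
  finally have Es: "expectation (\<lambda>\<omega>. \<Sum>k\<le>\<tau>. w k \<omega> * (q k \<omega> - r)) = \<dots>" .
  have "mean_const_inv r (Suc \<tau>) + (\<Sum>k\<le>\<tau>. expectation (w k) * (expectation (q k) - r)) =
      expectation (\<lambda>\<omega>. ?R \<omega> + (\<Sum>k\<le>\<tau>. w k \<omega> * (q k \<omega> - r)))"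
    by (subst Bochner_Integration.integral_add[OF const_inv_integrable[OF r] isum])
       (simp only: Es expectation_const_inv)
  also have "\<dots> \<le> expectation (\<lambda>\<omega>. prior_inv \<tau> A (\<lambda>s. D s \<omega>) (t + Suc \<tau>))"
    using isum const_inv_integrable[OF r, of t "Suc \<tau>"] iJ prior_inv_ge_subgradient[of r "\<lambda>s. D s _" t "Suc \<tau>" \<tau> A]
    by (intro integral_mono) (auto simp: w_def q_def lessThan_Suc_atMost)
  finally show ?thesis by (simp add: Ew q_def)
qed

end

lemma ex_grid_point:
  fixes \<mu> x :: real
  assumes "m > 0" "\<mu> > 0" "0 \<le> x" "x \<le> \<mu>"
  shows "\<exists>i<m. real i * \<mu> / real m \<le> x \<and> x \<le> (real i + 1) * \<mu> / real m"
proof (cases "x = \<mu>")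
  \<comment> \<open>At \<open>x = \<mu>\<close> the floor would be \<open>m\<close>; the last cell
    is used instead.\<close>
  case True
  then show ?thesis
    using assms by (intro exI[of _ "m - 1"]) (auto simp: field_simps of_nat_diff)
next
  case False
  define i where "i = nat \<lfloor>x * real m / \<mu>\<rfloor>"
  have nn: "0 \<le> x * real m / \<mu>" using assms by simp
  have lt: "x * real m / \<mu> < real m" using assms False by (simp add: field_simps)
  have i: "real i \<le> x * real m / \<mu>" "x * real m / \<mu> < real i + 1"
    using nn unfolding i_def by linarith+
  then have "real i < real m" using lt by linarith
  then have "i < m" by simp
  then show ?thesis
    using i assms by (intro exI[of _ i]) (auto simp: field_simps)
qed

section \<open>Lower bound for arbitrary policies\<close>

context exponential_demand
begin

text \<open>Costs are nonnegative, so a finite expected average controls each of its terms. For an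
  arbitrary policy, this is where integrability comes from.\<close>

lemma integrable_period_cost_of_average:
  assumes A: "A \<in> policies \<tau>" and hp: "h \<ge> 0" "p \<ge> 0"
    and fin: "(\<integral>\<^sup>+\<omega>. ennreal ((\<Sum>s<Suc n. period_cost h p \<tau> A (\<lambda>s. D s \<omega>) (\<tau> + s)) / real (Suc n)) \<partial>M) < \<infinity>"
    and s: "s < Suc n"
  shows "integrable M (\<lambda>\<omega>. period_cost h p \<tau> A (\<lambda>s. D s \<omega>) (\<tau> + s))"
proof -
  let ?c = "\<lambda>s \<omega>. period_cost h p \<tau> A (\<lambda>s. D s \<omega>) (\<tau> + s)"
  have [measurable]: "?c s \<in> borel_measurable M" for s using A by simp
  have nn: "?c s \<omega> \<ge> 0" for s \<omega> using hp by (rule period_cost_nonneg)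
  have "integrable M (\<lambda>\<omega>. (\<Sum>s<Suc n. ?c s \<omega>) / real (Suc n))"
  proof (rule integrableI_nonneg)
    show "AE \<omega> in M. 0 \<le> (\<Sum>s<Suc n. ?c s \<omega>) / real (Suc n)"
      by (intro always_eventually allI divide_nonneg_nonneg sum_nonneg nn) simp
  qed (use fin in \<open>simp_all del: sum.lessThan_Suc\<close>)
  then have "integrable M (\<lambda>\<omega>. real (Suc n) * ((\<Sum>s<Suc n. ?c s \<omega>) / real (Suc n)))"
    by (rule integrable_mult_right)
  then have "integrable M (\<lambda>\<omega>. \<Sum>s<Suc n. ?c s \<omega>)"
    by (simp del: sum.lessThan_Suc of_nat_Suc)
  then show ?thesis
  proof (rule Bochner_Integration.integrable_bound)
    have "?c s \<omega> \<le> (\<Sum>s<Suc n. ?c s \<omega>)" for \<omega>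
      using s nn by (intro member_le_sum) auto
    then have "norm (?c s \<omega>) \<le> norm (\<Sum>s<Suc n. ?c s \<omega>)" for \<omega>
      using nn by (metis abs_ge_self abs_of_nonneg order_trans real_norm_def)
    then show "AE \<omega> in M. norm (?c s \<omega>) \<le> norm (\<Sum>s<Suc n. ?c s \<omega>)"
      by (simp del: sum.lessThan_Suc)
  qed simp
qed

text \<open>With \<open>Q\<close> the total expected order, the inventory is bounded below by the
  subgradient inequality at \<open>r = Q / N\<close> and the lost sales by the material balance. The
  offset \<open>p * \<tau> * \<mu>\<close> pays for the demands of the first \<open>\<tau>\<close>
  periods and is independent of \<open>N\<close>.\<close>

lemma expected_total_cost_ge:
  assumes A: "A \<in> policies \<tau>" and hp: "h > 0" "p > 0"
    and int: "\<And>s. s < N \<Longrightarrow> integrable M (\<lambda>\<omega>. period_cost h p \<tau> A (\<lambda>s. D s \<omega>) (\<tau> + s))"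
    and N: "N > 0"
    and c: "\<And>r. 0 \<le> r \<Longrightarrow> r \<le> \<mu> \<Longrightarrow> c \<le> h * mean_const_inv r (Suc \<tau>) + p * (\<mu> - r)"
  shows "real N * c - p * \<tau> * \<mu> \<le> (\<Sum>s<N. expectation (\<lambda>\<omega>. period_cost h p \<tau> A (\<lambda>s. D s \<omega>) (\<tau> + s)))"
proof -
  define J where "J = (\<lambda>s \<omega>. prior_inv \<tau> A (\<lambda>s. D s \<omega>) (Suc s))"
  define L where "L = (\<lambda>s \<omega>. lost_sales \<tau> A (\<lambda>s. D s \<omega>) s)"
  define q where "q = (\<lambda>s \<omega>. order_qty \<tau> A (\<lambda>s. D s \<omega>) s)"
  have [measurable]: "J s \<in> borel_measurable M" "L s \<in> borel_measurable M" "q s \<in> borel_measurable M" for s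
    using A by (simp_all add: J_def L_def q_def lost_sales_def)
  have J0: "J s \<omega> \<ge> 0" for s \<omega> by (simp add: J_def prior_inv_nonneg)
  have L0: "L s \<omega> \<ge> 0" for s \<omega> by (simp add: L_def lost_sales_def)
  have q0: "q s \<omega> \<ge> 0" for s \<omega> by (simp add: q_def order_qty_nonneg[OF A])
  have cost: "period_cost h p \<tau> A (\<lambda>s. D s \<omega>) s = h * J s \<omega> + p * L s \<omega>" for s \<omega>
    by (simp add: period_cost_def end_inv_eq J_def L_def)
  have iJ: "integrable M (J (\<tau> + s))" and iL: "integrable M (L (\<tau> + s))" if "s < N" for s
  proof -
    have "norm (J (\<tau> + s) \<omega>) \<le> norm (period_cost h p \<tau> A (\<lambda>s. D s \<omega>) (\<tau> + s) / h)"
      "norm (L (\<tau> + s) \<omega>) \<le> norm (period_cost h p \<tau> A (\<lambda>s. D s \<omega>) (\<tau> + s) / p)" for \<omega>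
    proof -
      have "0 \<le> p * L (\<tau> + s) \<omega> / h" "0 \<le> h * J (\<tau> + s) \<omega> / p"
        using hp J0 L0 by simp_all
      moreover have "period_cost h p \<tau> A (\<lambda>s. D s \<omega>) (\<tau> + s) / h = J (\<tau> + s) \<omega> + p * L (\<tau> + s) \<omega> / h"
        "period_cost h p \<tau> A (\<lambda>s. D s \<omega>) (\<tau> + s) / p = h * J (\<tau> + s) \<omega> / p + L (\<tau> + s) \<omega>"
        using hp by (simp_all add: cost add_divide_distrib)
      ultimately show "norm (J (\<tau> + s) \<omega>) \<le> norm (period_cost h p \<tau> A (\<lambda>s. D s \<omega>) (\<tau> + s) / h)"
        "norm (L (\<tau> + s) \<omega>) \<le> norm (period_cost h p \<tau> A (\<lambda>s. D s \<omega>) (\<tau> + s) / p)"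
        using J0 L0 by simp_all
    qed
    note le = this
    have div: "integrable M (\<lambda>\<omega>. period_cost h p \<tau> A (\<lambda>s. D s \<omega>) (\<tau> + s) / x)" for x
      using int[OF that] by (intro integrable_divide_zero)
    show "integrable M (J (\<tau> + s))"
      by (rule Bochner_Integration.integrable_bound[OF div[of h]]) (use le(1) in simp_all)
    show "integrable M (L (\<tau> + s))"
      by (rule Bochner_Integration.integrable_bound[OF div[of p]]) (use le(2) in simp_all)
  qed
  have q_init: "q s = (\<lambda>_. 0)" if "s < \<tau>" for s
    using that by (simp add: q_def order_qty.simps)
  \<comment> \<open>The stock before arrival is nonnegative, so an order is at most the end
    inventory plus the demand of its period.\<close>
  have iq: "integrable M (q s)" if "s < \<tau> + N" for s
  proof (cases "s < \<tau>")
    case False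
    then have "integrable M (J s)"
      using iJ[of "s - \<tau>"] that by simp
    then have "integrable M (\<lambda>\<omega>. J s \<omega> + D s \<omega>)"
      using demand_integrable by simp
    then show ?thesis
    proof (rule Bochner_Integration.integrable_bound)
      have "q s \<omega> \<le> J s \<omega> + D s \<omega>" for \<omega>
        using prior_inv_nonneg[of \<tau> A "\<lambda>s. D s \<omega>" s] by (simp add: J_def q_def prior_inv_Suc)
      then have "\<bar>q s \<omega>\<bar> \<le> J s \<omega> + D s \<omega>" for \<omega>
        by (simp add: q0)
      then have "norm (q s \<omega>) \<le> norm (J s \<omega> + D s \<omega>)" for \<omega>
        unfolding real_norm_def by (rule order.trans[OF _ abs_ge_self])
      then show "AE \<omega> in M. norm (q s \<omega>) \<le> norm (J s \<omega> + D s \<omega>)"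
        by simp
    qed simp
  qed (simp add: q_init)
  define Q where "Q = (\<Sum>s<N. expectation (q s))"
  have Eq0: "expectation (q s) \<ge> 0" for s
    using q0 by (intro integral_nonneg_AE) auto
  have Q0: "Q \<ge> 0" unfolding Q_def by (intro sum_nonneg Eq0)
  have lost: "real N * \<mu> - Q - real \<tau> * \<mu> \<le> (\<Sum>s<N. expectation (L (\<tau> + s)))"
  proof -
    have i1: "integrable M (\<lambda>\<omega>. (\<Sum>s<N. D s \<omega> - q s \<omega>) - (\<Sum>s<\<tau>. D s \<omega>))"
      using iq demand_integrable by (intro Bochner_Integration.integrable_diff Bochner_Integration.integrable_sum) auto
    have i2: "integrable M (\<lambda>\<omega>. \<Sum>s<N. L (\<tau> + s) \<omega>)"
      using iL by (intro Bochner_Integration.integrable_sum) auto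
    have "expectation (\<lambda>\<omega>. (\<Sum>s<N. D s \<omega> - q s \<omega>) - (\<Sum>s<\<tau>. D s \<omega>)) \<le>
        expectation (\<lambda>\<omega>. \<Sum>s<N. L (\<tau> + s) \<omega>)"
    proof (rule integral_mono_AE[OF i1 i2])
      show "AE \<omega> in M. (\<Sum>s<N. D s \<omega> - q s \<omega>) - (\<Sum>s<\<tau>. D s \<omega>) \<le> (\<Sum>s<N. L (\<tau> + s) \<omega>)"
        using AE_demand_nonneg
      proof eventually_elim
        case (elim \<omega>)
        then show ?case
          using sum_lost_sales_ge[OF A, of "\<lambda>s. D s \<omega>" N] by (simp add: L_def q_def)
      qed
    qed
    also have "expectation (\<lambda>\<omega>. (\<Sum>s<N. D s \<omega> - q s \<omega>) - (\<Sum>s<\<tau>. D s \<omega>)) =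
        expectation (\<lambda>\<omega>. \<Sum>s<N. D s \<omega> - q s \<omega>) - expectation (\<lambda>\<omega>. \<Sum>s<\<tau>. D s \<omega>)"
      using iq demand_integrable
      by (intro Bochner_Integration.integral_diff Bochner_Integration.integrable_sum) auto
    also have "expectation (\<lambda>\<omega>. \<Sum>s<N. D s \<omega> - q s \<omega>) = (\<Sum>s<N. expectation (\<lambda>\<omega>. D s \<omega> - q s \<omega>))"
      using iq demand_integrable by (intro Bochner_Integration.integral_sum) auto
    also have "\<dots> = (\<Sum>s<N. \<mu> - expectation (q s))"
      using iq demand_integrable by (intro sum.cong) (auto simp: expectation_demand)
    also have "\<dots> = real N * \<mu> - Q"
      by (simp add: sum_subtractf Q_def)
    also have "expectation (\<lambda>\<omega>. \<Sum>s<\<tau>. D s \<omega>) = real \<tau> * \<mu>"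
      using demand_integrable by (simp add: Bochner_Integration.integral_sum expectation_demand)
    also have "expectation (\<lambda>\<omega>. \<Sum>s<N. L (\<tau> + s) \<omega>) = (\<Sum>s<N. expectation (L (\<tau> + s)))"
      using iL by (intro Bochner_Integration.integral_sum) auto
    finally show ?thesis .
  qed
  have lost0: "0 \<le> (\<Sum>s<N. expectation (L (\<tau> + s)))"
    using L0 by (intro sum_nonneg integral_nonneg_AE) auto
  \<comment> \<open>The weights are nonnegative, so \<open>real N * r \<le> Q\<close> suffices; the
    case of excessive orders takes \<open>r = \<mu>\<close>.\<close>
  have hold: "real N * mean_const_inv r (Suc \<tau>) \<le> (\<Sum>s<N. expectation (J (\<tau> + s)))"
    if r: "r \<ge> 0" "real N * r \<le> Q" for r
  proof -
    let ?w = "\<lambda>k. expectation (\<lambda>\<omega>. const_inv_deriv r (\<lambda>k. D k \<omega>) (Suc \<tau>) k)"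
    have w: "?w k \<ge> 0" for k
      using const_inv_deriv_bounds by (intro integral_nonneg_AE) auto
    \<comment> \<open>Orders arriving before period \<open>\<tau>\<close> are 0, so shifting the
      summation range by a lag \<open>k \<le> \<tau>\<close> loses nothing of \<open>Q\<close> and
      adds only nonnegative terms.\<close>
    have window: "real N * r \<le> (\<Sum>t<N. expectation (q (t + k)))" if k: "k \<le> \<tau>" for k
    proof -
      have "Q = (\<Sum>s\<in>{k..<N}. expectation (q s))"
        unfolding Q_def using k by (intro sum.mono_neutral_right) (auto simp: q_init)
      also have "\<dots> \<le> (\<Sum>s\<in>{k..<N + k}. expectation (q s))"
        by (intro sum_mono2 Eq0) auto
      also have "\<dots> = (\<Sum>t<N. expectation (q (t + k)))"
        using sum.shift_bounds_nat_ivl[of "\<lambda>s. expectation (q s)" 0 k N] by (simp add: lessThan_atLeast0)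
      finally show ?thesis using r by simp
    qed
    have "0 \<le> (\<Sum>k\<le>\<tau>. ?w k * ((\<Sum>t<N. expectation (q (t + k))) - real N * r))"
      using window w by (intro sum_nonneg mult_nonneg_nonneg) auto
    also have "\<dots> = (\<Sum>k\<le>\<tau>. \<Sum>t<N. ?w k * (expectation (q (t + k)) - r))"
      by (simp add: sum_subtractf sum_distrib_left[symmetric])
    also have "\<dots> = (\<Sum>t<N. \<Sum>k\<le>\<tau>. ?w k * (expectation (q (t + k)) - r))"
      by (rule sum.swap)
    finally have "real N * mean_const_inv r (Suc \<tau>) \<le>
        (\<Sum>t<N. mean_const_inv r (Suc \<tau>) + (\<Sum>k\<le>\<tau>. ?w k * (expectation (q (t + k)) - r)))"
      by (simp add: sum.distrib)
    also have "\<dots> \<le> (\<Sum>t<N. expectation (J (\<tau> + t)))"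
    proof (rule sum_mono)
      fix t assume "t \<in> {..<N}"
      then show "mean_const_inv r (Suc \<tau>) + (\<Sum>k\<le>\<tau>. ?w k * (expectation (q (t + k)) - r))
          \<le> expectation (J (\<tau> + t))"
        using expectation_prior_inv_ge[OF A r(1), of t] iq iJ[of t]
        by (simp add: q_def J_def add.commute)
    qed
    finally show ?thesis .
  qed
  have total: "(\<Sum>s<N. expectation (\<lambda>\<omega>. period_cost h p \<tau> A (\<lambda>s. D s \<omega>) (\<tau> + s))) =
      h * (\<Sum>s<N. expectation (J (\<tau> + s))) + p * (\<Sum>s<N. expectation (L (\<tau> + s)))"
    unfolding cost sum_distrib_left sum.distrib[symmetric] using iJ iL by (intro sum.cong) auto
  show ?thesis
  proof (cases "Q \<le> real N * \<mu>")
    case True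
    define r where "r = Q / real N"
    have r: "0 \<le> r" "r \<le> \<mu>" "real N * r = Q"
      using Q0 N True by (auto simp: r_def field_simps)
    have "real N * c \<le> real N * (h * mean_const_inv r (Suc \<tau>) + p * (\<mu> - r))"
      using c[OF r(1,2)] by (intro mult_left_mono) auto
    also have "\<dots> = h * (real N * mean_const_inv r (Suc \<tau>)) + p * (real N * \<mu> - Q)"
      unfolding r(3)[symmetric] by (simp add: algebra_simps)
    also have "\<dots> - p * \<tau> * \<mu> = h * (real N * mean_const_inv r (Suc \<tau>)) + p * (real N * \<mu> - Q - real \<tau> * \<mu>)"
      by (simp add: algebra_simps)
    also have "\<dots> \<le> h * (\<Sum>s<N. expectation (J (\<tau> + s))) + p * (\<Sum>s<N. expectation (L (\<tau> + s)))"
      using hp hold[of r] r lost by (intro add_mono mult_left_mono) auto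
    finally show ?thesis unfolding total by simp
  next
    \<comment> \<open>The mean order exceeds \<open>\<mu>\<close>: lost sales are bounded below by 0
      only, and the comparison is made at \<open>r = \<mu>\<close>.\<close>
    case False
    have "real N * c \<le> real N * (h * mean_const_inv \<mu> (Suc \<tau>) + p * (\<mu> - \<mu>))"
      using c[of \<mu>] mean_pos by (intro mult_left_mono) auto
    also have "\<dots> = h * (real N * mean_const_inv \<mu> (Suc \<tau>))" by simp
    also have "\<dots> \<le> h * (\<Sum>s<N. expectation (J (\<tau> + s)))"
      using hp hold[of \<mu>] False mean_pos by (intro mult_left_mono) auto
    also have "\<dots> \<le> h * (\<Sum>s<N. expectation (J (\<tau> + s))) + p * (\<Sum>s<N. expectation (L (\<tau> + s)))"
      using hp lost0 by simp
    finally have "real N * c \<le> (\<Sum>s<N. expectation (\<lambda>\<omega>. period_cost h p \<tau> A (\<lambda>s. D s \<omega>) (\<tau> + s)))"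
      unfolding total .
    moreover have "0 \<le> p * \<tau> * \<mu>" using hp mean_pos by simp
    ultimately show ?thesis by linarith
  qed
qed

text \<open>The offset is divided by \<open>Suc n\<close> and vanishes in the limit. Horizons with
  infinite expected cost satisfy the bound trivially; on all others each period cost is
  integrable.\<close>

lemma cost_rate_ge:
  assumes A: "A \<in> policies \<tau>" and hp: "h > 0" "p > 0"
    and c: "\<And>r. 0 \<le> r \<Longrightarrow> r \<le> \<mu> \<Longrightarrow> c \<le> h * mean_const_inv r (Suc \<tau>) + p * (\<mu> - r)"
  shows "ereal c \<le> cost_rate M D h p \<tau> A"
proof -
  have "ereal c = limsup (\<lambda>n. ereal (c + (- (p * \<tau> * \<mu>)) / real (Suc n)))"
    by (rule lim_imp_Limsup[OF _ const_plus_over_Suc_tendsto, symmetric]) simp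
  also have "\<dots> \<le> cost_rate M D h p \<tau> A"
    unfolding cost_rate_eq_limsup
  proof (intro Limsup_mono always_eventually allI)
    fix n
    let ?I = "\<integral>\<^sup>+\<omega>. ennreal ((\<Sum>s<Suc n. period_cost h p \<tau> A (\<lambda>s. D s \<omega>) (\<tau> + s)) / real (Suc n)) \<partial>M"
    show "ereal (c + (- (p * \<tau> * \<mu>)) / real (Suc n)) \<le> enn2ereal ?I"
    proof (cases "?I < \<infinity>")
      case True
      note int = integrable_period_cost_of_average[OF A less_imp_le[OF hp(1)] less_imp_le[OF hp(2)] True]
      have "c + (- (p * \<tau> * \<mu>)) / real (Suc n) = (real (Suc n) * c - p * \<tau> * \<mu>) / real (Suc n)"
        by (simp add: diff_divide_distrib)
      also have "\<dots> \<le> (\<Sum>s<Suc n. expectation (\<lambda>\<omega>. period_cost h p \<tau> A (\<lambda>s. D s \<omega>) (\<tau> + s))) / real (Suc n)"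
        by (intro divide_right_mono expected_total_cost_ge[OF A hp int _ c]) auto
      finally show ?thesis
        using hp int by (subst expected_average_cost) auto
    next
      case False
      then have "?I = \<infinity>" by (simp add: less_top[symmetric])
      then show ?thesis by simp
    qed
  qed
  finally show ?thesis .
qed

section \<open>The limit of long lead times\<close>

text \<open>
  Monotonicity of \<open>mean_const_inv\<close> in the order quantity reduces the uniform bound to the points of
  a finite grid.
\<close>

lemma eventually_truncated_rate_ge:
  assumes hp: "h > 0" "p > 0" and \<epsilon>: "\<epsilon> > 0"
    and G: "\<And>r. 0 \<le> r \<Longrightarrow> r < \<mu> \<Longrightarrow> G \<le> const_rate h p \<mu> r"
  shows "eventually (\<lambda>n. \<forall>r. 0 \<le> r \<longrightarrow> r \<le> \<mu> \<longrightarrow>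
    G - \<epsilon> \<le> h * mean_const_inv r (Suc n) + p * (\<mu> - r)) sequentially"
proof -
  \<comment> \<open>Over a cell of width \<open>\<mu> / m\<close> the term
    \<open>p * (\<mu> - r)\<close> varies by at most \<open>\<epsilon> / 2\<close>; the other half
    is left for the convergence at the grid points.\<close>
  obtain m :: nat where m: "2 * p * \<mu> / \<epsilon> < real m"
    using reals_Archimedean2 by blast
  have "0 < 2 * p * \<mu> / \<epsilon>" using hp \<epsilon> mean_pos by simp
  then have m0: "m > 0" using m by simp
  have step: "p * (\<mu> / real m) \<le> \<epsilon> / 2"
    using m m0 \<epsilon> by (simp add: field_simps)
  \<comment> \<open>Left end points stay below \<open>\<mu>\<close>, where the limit of
    \<open>mean_const_inv\<close> is finite.\<close>
  define x where "x = (\<lambda>i. real i * \<mu> / real m)"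
  have x: "0 \<le> x i" "i < m \<Longrightarrow> x i < \<mu>" for i
    using m0 mean_pos by (auto simp: x_def field_simps)
  have "eventually (\<lambda>n. h * mean_const_inv (x i) (Suc n) + p * (\<mu> - x i) \<ge> G - \<epsilon> / 2) sequentially"
    if i: "i < m" for i
  proof -
    obtain K where K: "\<And>n. mean_const_inv (x i) (Suc n) \<ge> (x i)\<^sup>2 / (2 * (\<mu> - x i)) - K / real (Suc n)"
      using mean_const_inv_lower[OF x(1) x(2)[OF i]] by metis
    have "(\<lambda>n. h * K / real (Suc n)) \<longlonglongrightarrow> 0"
      by (rule LIMSEQ_Suc[OF lim_const_over_n])
    then have "eventually (\<lambda>n. h * K / real (Suc n) < \<epsilon> / 2) sequentially"
      using \<epsilon> by (intro order_tendstoD) auto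
    then show ?thesis
    proof eventually_elim
      case (elim n)
      have "G \<le> h * ((x i)\<^sup>2 / (2 * (\<mu> - x i))) + p * (\<mu> - x i)"
        using G[OF x(1) x(2)[OF i]] by (simp add: const_rate_def)
      moreover have "h * ((x i)\<^sup>2 / (2 * (\<mu> - x i)) - K / real (Suc n)) \<le> h * mean_const_inv (x i) (Suc n)"
        using K hp by (intro mult_left_mono) auto
      ultimately show ?case using elim by (simp add: right_diff_distrib)
    qed
  qed
  then have "eventually (\<lambda>n. \<forall>i\<in>{..<m}. h * mean_const_inv (x i) (Suc n) + p * (\<mu> - x i) \<ge> G - \<epsilon> / 2) sequentially"
    by (intro eventually_ball_finite) auto
  then show ?thesis
  proof eventually_elim
    case (elim n)
    show ?case
    proof (intro allI impI)
      fix r assume r: "0 \<le> r" "r \<le> \<mu>"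
      obtain i where i: "i < m" "x i \<le> r" "r \<le> x i + \<mu> / real m"
        using ex_grid_point[OF m0 mean_pos r] by (auto simp: x_def add_divide_distrib distrib_right)
      \<comment> \<open>Passing to the left end point does not raise the holding term and raises the
        lost sales term by at most \<open>\<epsilon> / 2\<close>.\<close>
      have "h * mean_const_inv (x i) (Suc n) \<le> h * mean_const_inv r (Suc n)"
        using hp i x by (intro mult_left_mono mean_const_inv_mono) auto
      moreover have "p * (\<mu> - x i) \<le> p * (\<mu> - r) + \<epsilon> / 2"
      proof -
        have "p * r \<le> p * (x i + \<mu> / real m)"
          using i hp by (intro mult_left_mono) auto
        then show ?thesis using step unfolding right_diff_distrib distrib_left by linarith
      qed
      ultimately show "G - \<epsilon> \<le> h * mean_const_inv r (Suc n) + p * (\<mu> - r)"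
        using bspec[OF elim, of i] i(1) by simp
    qed
  qed
qed

text \<open>A sandwich: eventually \<open>G - \<epsilon> \<le> C* \<le> C(P) \<le> G\<close>, where
  the minimum \<open>G\<close> of the rate does not depend on \<open>\<tau>\<close> even if the
  minimizer \<open>r \<tau>\<close> does.\<close>

lemma optimality_gap_tendsto_0:
  assumes hp: "h > 0" "p > 0" and r: "\<And>\<tau>. 0 \<le> r \<tau>" "\<And>\<tau>. r \<tau> < \<mu>"
    and opt: "\<And>\<tau> s. 0 \<le> s \<Longrightarrow> s < \<mu> \<Longrightarrow> const_rate h p \<mu> (r \<tau>) \<le> const_rate h p \<mu> s"
  shows "(\<lambda>\<tau>. cost_rate M D h p \<tau> (pil_policy M D \<tau> (p * (\<mu> - r \<tau>) / h))
    - optimal_cost_rate M D h p \<tau>) \<longlonglongrightarrow> 0"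
proof -
  define G where "G = const_rate h p \<mu> (r 0)"
  have rate: "const_rate h p \<mu> (r \<tau>) = G" for \<tau>
    unfolding G_def by (intro antisym opt r)
  let ?P = "\<lambda>\<tau>. cost_rate M D h p \<tau> (pil_policy M D \<tau> (p * (\<mu> - r \<tau>) / h))"
  let ?O = "\<lambda>\<tau>. optimal_cost_rate M D h p \<tau>"
  have P: "?P \<tau> \<le> ereal G" for \<tau>
    using cost_rate_pil_policy_le[OF hp r, of \<tau> \<tau>] by (simp add: rate)
  have OP: "?O \<tau> \<le> ?P \<tau>" for \<tau>
    unfolding optimal_cost_rate_def by (intro INF_lower pil_policy_in_policies)
  have O: "eventually (\<lambda>\<tau>. ereal (G - \<epsilon>) \<le> ?O \<tau>) sequentially" if "\<epsilon> > 0" for \<epsilon>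
  proof -
    have "eventually (\<lambda>n. \<forall>r. 0 \<le> r \<longrightarrow> r \<le> \<mu> \<longrightarrow>
        G - \<epsilon> \<le> h * mean_const_inv r (Suc n) + p * (\<mu> - r)) sequentially"
      using eventually_truncated_rate_ge[OF hp that, of G] opt by (simp add: G_def)
    then show ?thesis
    proof eventually_elim
      case (elim \<tau>)
      then show ?case
        unfolding optimal_cost_rate_def by (intro INF_greatest cost_rate_ge[OF _ hp]) auto
    qed
  qed
  show ?thesis
  proof (rule order_tendstoI)
    fix a :: ereal assume "a < 0"
    have "eventually (\<lambda>\<tau>. ereal (G - 1) \<le> ?O \<tau>) sequentially" by (rule O) simp
    then show "eventually (\<lambda>\<tau>. a < ?P \<tau> - ?O \<tau>) sequentially"
    proof eventually_elim
      case (elim \<tau>)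
      have "\<bar>?O \<tau>\<bar> \<noteq> \<infinity>"
        using elim order.trans[OF OP P, of \<tau>] by auto
      then have "0 \<le> ?P \<tau> - ?O \<tau>"
        using OP[of \<tau>] by (simp add: ereal_diff_positive)
      then show ?case using \<open>a < 0\<close> by (rule less_le_trans[rotated])
    qed
  next
    fix a :: ereal assume "0 < a"
    then obtain \<epsilon> where \<epsilon>: "0 < ereal \<epsilon>" "ereal \<epsilon> < a"
      using ereal_dense2 by blast
    have "eventually (\<lambda>\<tau>. ereal (G - \<epsilon>) \<le> ?O \<tau>) sequentially"
      using \<epsilon> by (intro O) simp
    then show "eventually (\<lambda>\<tau>. ?P \<tau> - ?O \<tau> < a) sequentially"
    proof eventually_elim
      case (elim \<tau>)
      have "?P \<tau> - ?O \<tau> \<le> ereal G - ereal (G - \<epsilon>)"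
        by (intro ereal_minus_mono P elim)
      then show ?case using \<epsilon> by simp
    qed
  qed
qed

end

theorem theorem2:
  fixes M :: "'a measure" and D :: "nat \<Rightarrow> 'a \<Rightarrow> real"
    and \<mu> h p :: real and rstar :: "nat \<Rightarrow> real"
  assumes "prob_space M"
    and "h > 0" and "p > 0" and "\<mu> > 0"
    and "prob_space.indep_vars M (\<lambda>_. borel) D UNIV"
    and "\<And>t. distributed M lborel (D t) (exponential_density (1 / \<mu>))"
    and "\<And>\<tau>. is_arg_min (\<lambda>r. cost_rate M D h p \<tau> (const_policy r)) (\<lambda>r. r \<in> {0..<\<mu>}) (rstar \<tau>)"
  shows "(\<lambda>\<tau>. cost_rate M D h p \<tau> (pil_policy M D \<tau> (p * (\<mu> - rstar \<tau>) / h))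
                - optimal_cost_rate M D h p \<tau>) \<longlonglongrightarrow> 0"
proof -
  interpret exponential_demand M D \<mu>
    using assms by (simp add: exponential_demand_def exponential_demand_axioms_def)
  have r: "0 \<le> rstar \<tau>" "rstar \<tau> < \<mu>" for \<tau>
    using assms(7)[of \<tau>] by (auto simp: is_arg_min_def)
  show ?thesis
  proof (rule optimality_gap_tendsto_0[OF assms(2,3) r])
    fix \<tau> s assume s: "0 \<le> s" "s < \<mu>"
    then have "cost_rate M D h p \<tau> (const_policy (rstar \<tau>)) \<le> cost_rate M D h p \<tau> (const_policy s)"
      using assms(7)[of \<tau>] by (auto simp: is_arg_min_linorder)
    then show "const_rate h p \<mu> (rstar \<tau>) \<le> const_rate h p \<mu> s"
      using assms(2,3) r s by (simp add: cost_rate_const_policy)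
  qed
qed

end
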